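(* Let $G\le\mathrm{Aut}(T)$ be a weakly branch group, $X$ a minimal compact $G$-space, and $\Phi:X\to\mathrm{Sub}(G)$ a lower semi-continuous $G$-equivariant map. Then: (i) the map $\Psi:X\to\mathcal{F}(\partial T)$, $x\mapsto\mathrm{Fix}(\Phi(x))$, is continuous; (ii) letting $F_X$ be the image of $\Psi$, there exists a continuous $G$-equivariant map $\sigma:F_X\to\Pi(T)$ such that (a) $\pi_\perp\circ\sigma=\mathrm{id}$, and (b) for every $x\in X$ and every $v\in\sigma(\mathrm{Fix}(\Phi(x)))$ one has $\mathrm{Rist}_G(v)'\le\Phi(x)$.
   Context: $T$ is a locally finite rooted tree, $\mathrm{Aut}(T)$ the root-fixing automorphisms, $\partial T$ the boundary; $T_v$ is the subtree below a vertex $v$, $\partial T_v$ the corresponding clopen set, $\mathrm{Rist}_G(v)$ the elements of $G$ acting trivially outside $T_v$; $K'$ is the derived subgroup. $G$ is weakly branch if $T$ is infinite and spherically homogeneous, $G$ is transitive on each level, and $\mathrm{Rist}_G(v)\ne\{1\}$ for all $v$. $\mathrm{Sub}(G)$ is the space of subgroups with the Chabauty topology, $G$ acting by conjugation. $\Phi$ is lower semi-continuous if whenever $x_i\to x$ and $\Phi(x_i)\to K$ in $\mathrm{Sub}(G)$, then $\Phi(x)\le K$ (equivalently, $\{x:g\in\Phi(x)\}$ is open for every $g\in G$). $\mathcal{F}(\partial T)$ is the space of closed subsets of $\partial T$ with the Hausdorff topology; $\mathrm{Fix}(H)$ is the set of fixed points in $\partial T$ of $H$. $\Pi(T)$ is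 the set of sets of pairwise independent vertices ($T_v\cap T_w=\varnothing$ for distinct $v,w$), topologized as a subspace of $\{0,1\}^{V(T)}$, and $\pi_\perp(\mathcal{V})=\partial T\setminus\bigsqcup_{v\in\mathcal{V}}\partial T_v$. *)

theory Defs
  imports "HOL-Analysis.Analysis" "HOL-Algebra.Algebra" "HOL-Library.Sublist"
begin

text \<open>A locally finite rooted tree is represented by its vertex set V, a set of
finite words over nat: the root is the empty word, V is closed under prefixes,
and every vertex has finitely many children v@[i].  Every locally finite rooted
tree is isomorphic to one of this form.\<close>

definition rooted_tree :: "nat list set \<Rightarrow> bool" where
  "rooted_tree V \<longleftrightarrow> [] \<in> V \<and> (\<forall>v w. v @ w \<in> V \<longrightarrow> v \<in> V)
     \<and> (\<forall>v\<in>V. finite {i. v @ [i] \<in> V})"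

definition children :: "nat list set \<Rightarrow> nat list \<Rightarrow> nat set" where
  "children V v = {i. v @ [i] \<in> V}"

definition spherically_homogeneous :: "nat list set \<Rightarrow> bool" where
  "spherically_homogeneous V \<longleftrightarrow>
     (\<forall>v\<in>V. \<forall>w\<in>V. length v = length w \<longrightarrow> card (children V v) = card (children V w))"

definition subtree :: "nat list set \<Rightarrow> nat list \<Rightarrow> nat list set" where
  "subtree V v = {w \<in> V. prefix v w}"

text \<open>Automorphisms are order isomorphisms of (V, prefix), extended by the
identity outside V (so that they form a group under composition).\<close>
definition aut :: "nat list set \<Rightarrow> (nat list \<Rightarrow> nat list) set" where
  "aut V = {g. bij_betw g V V \<and> (\<forall>x. x \<notin> V \<longrightarrow> g x = x)
              \<and> (\<forall>v\<in>V. \<forall>w\<in>V. prefix v w \<longleftrightarrow> prefix (g v) (g w))}"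

definition aut_group :: "nat list set \<Rightarrow> (nat list \<Rightarrow> nat list) monoid" where
  "aut_group V = \<lparr>carrier = aut V, mult = (\<circ>), one = id\<rparr>"

definition rist :: "nat list set \<Rightarrow> (nat list \<Rightarrow> nat list) set \<Rightarrow> nat list \<Rightarrow> (nat list \<Rightarrow> nat list) set" where
  "rist V G v = {g \<in> G. \<forall>w \<in> V - subtree V v. g w = w}"

definition weakly_branch :: "nat list set \<Rightarrow> (nat list \<Rightarrow> nat list) set \<Rightarrow> bool" where
  "weakly_branch V G \<longleftrightarrow> infinite V \<and> spherically_homogeneous V
     \<and> (\<forall>v\<in>V. \<forall>w\<in>V. length v = length w \<longrightarrow> (\<exists>g\<in>G. g v = w))
     \<and> (\<forall>v\<in>V. rist V G v \<noteq> {id})"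

definition boundary :: "nat list set \<Rightarrow> (nat \<Rightarrow> nat) set" where
  "boundary V = {\<xi>. \<forall>n. map \<xi> [0..<n] \<in> V}"

definition boundary_top :: "nat list set \<Rightarrow> (nat \<Rightarrow> nat) topology" where
  "boundary_top V = subtopology (product_topology (\<lambda>_. discrete_topology UNIV) UNIV) (boundary V)"

definition boundary_sub :: "nat list set \<Rightarrow> nat list \<Rightarrow> (nat \<Rightarrow> nat) set" where
  "boundary_sub V v = {\<xi> \<in> boundary V. map \<xi> [0..<length v] = v}"

definition bact :: "(nat list \<Rightarrow> nat list) \<Rightarrow> (nat \<Rightarrow> nat) \<Rightarrow> (nat \<Rightarrow> nat)" where
  "bact g \<xi> = (\<lambda>n. g (map \<xi> [0..<Suc n]) ! n)"

definition Fix :: "nat list set \<Rightarrow> (nat list \<Rightarrow> nat list) set \<Rightarrow> (nat \<Rightarrow> nat) set" where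
  "Fix V H = {\<xi> \<in> boundary V. \<forall>h\<in>H. bact h \<xi> = \<xi>}"

definition vietoris :: "'a topology \<Rightarrow> 'a set topology" where
  "vietoris T = topology_generated_by
     ({ {F. closedin T F \<and> F \<subseteq> U} | U. openin T U}
      \<union> { {F. closedin T F \<and> F \<inter> U \<noteq> {}} | U. openin T U})"

definition Pi_T :: "nat list set \<Rightarrow> nat list set set" where
  "Pi_T V = {P. P \<subseteq> V \<and> (\<forall>v\<in>P. \<forall>w\<in>P. v \<noteq> w \<longrightarrow> subtree V v \<inter> subtree V w = {})}"

text \<open>Product topology of {0,1}^A on subsets of A.\<close>
definition subset_top :: "'a set \<Rightarrow> 'a set topology" where
  "subset_top A = topology_generated_by
     ({ {S. S \<subseteq> A \<and> a \<in> S} | a. a \<in> A} \<union> { {S. S \<subseteq> A \<and> a \<notin> S} | a. a \<in> A})"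

definition Pi_top :: "nat list set \<Rightarrow> nat list set topology" where
  "Pi_top V = subtopology (subset_top V) (Pi_T V)"

definition pi_perp :: "nat list set \<Rightarrow> nat list set \<Rightarrow> (nat \<Rightarrow> nat) set" where
  "pi_perp V P = boundary V - (\<Union>v\<in>P. boundary_sub V v)"

definition top_action :: "'g monoid \<Rightarrow> 'x topology \<Rightarrow> ('g \<Rightarrow> 'x \<Rightarrow> 'x) \<Rightarrow> bool" where
  "top_action Gr Y act \<longleftrightarrow>
     (\<forall>g\<in>carrier Gr. continuous_map Y Y (act g))
     \<and> (\<forall>x\<in>topspace Y. act \<one>\<^bsub>Gr\<^esub> x = x)
     \<and> (\<forall>g\<in>carrier Gr. \<forall>h\<in>carrier Gr. \<forall>x\<in>topspace Y. act (g \<otimes>\<^bsub>Gr\<^esub> h) x = act g (act h x))"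

definition minimal_action :: "'g monoid \<Rightarrow> 'x topology \<Rightarrow> ('g \<Rightarrow> 'x \<Rightarrow> 'x) \<Rightarrow> bool" where
  "minimal_action Gr Y act \<longleftrightarrow>
     (\<forall>C. closedin Y C \<and> (\<forall>g\<in>carrier Gr. act g ` C \<subseteq> C) \<longrightarrow> C = {} \<or> C = topspace Y)"

definition sub_equivariant :: "'g monoid \<Rightarrow> 'x topology \<Rightarrow> ('g \<Rightarrow> 'x \<Rightarrow> 'x) \<Rightarrow> ('x \<Rightarrow> 'g set) \<Rightarrow> bool" where
  "sub_equivariant Gr Y act \<Phi> \<longleftrightarrow>
     (\<forall>g\<in>carrier Gr. \<forall>x\<in>topspace Y.
        \<Phi> (act g x) = (\<lambda>h. g \<otimes>\<^bsub>Gr\<^esub> h \<otimes>\<^bsub>Gr\<^esub> inv\<^bsub>Gr\<^esub> g) ` \<Phi> x)"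

text \<open>Lower semi-continuity into Sub(G) (G discrete, Chabauty topology).\<close>
definition sub_lsc :: "'g monoid \<Rightarrow> 'x topology \<Rightarrow> ('x \<Rightarrow> 'g set) \<Rightarrow> bool" where
  "sub_lsc Gr Y \<Phi> \<longleftrightarrow> (\<forall>g\<in>carrier Gr. openin Y {x \<in> topspace Y. g \<in> \<Phi> x})"

end

theory Submission
  imports Defs
begin

text \<open>For a vertex \<open>v\<close> let \<open>A\<^sub>v\<close> be the set of \<open>x\<close> such that \<open>\<Phi> x\<close> has no fixed point in the boundary of
  the subtree at \<open>v\<close>. By compactness and lower semi-continuity \<open>A\<^sub>v\<close> is open. The number of vertices \<open>v\<close> of a
  given level with \<open>x \<in> A\<^sub>v\<close> is then an invariant lower semi-continuous function of \<open>x\<close>, hence constant by minimality,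
  so each \<open>A\<^sub>v\<close> is clopen; this is the continuity of \<open>x \<mapsto> Fix(\<Phi> x)\<close>.

  For \<open>\<sigma>\<close> one cuts the complement of a closed set into the maximal cylinders that it contains, and subdivides each
  of them down to a level depending only on its own level. What is needed is a level, uniform over the compact set \<open>A\<^sub>v\<close>, at
  which \<open>\<Phi> x\<close> contains all derived rigid stabilizers. Compactness gives a level \<open>u\<close> below \<open>v\<close> and finitely many elements \<open>p\<close>
  moving \<open>u\<close> such that every \<open>\<Phi> x\<close> with \<open>x \<in> A\<^sub>v\<close> contains one of them. As \<open>A\<^sub>v\<close> is invariant under \<open>R = Rist(u)\<close>, this colours
  \<open>R\<close> by finitely many \<open>p\<close> so that \<open>g\<^sup>-\<^sup>1 p g \<in> \<Phi> x\<close> when \<open>g\<close> has colour \<open>p\<close>, and pigeonhole arguments together with the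
  fact that orbits of rigid stabilizers are uniformly large on deep levels do the rest.\<close>

section \<open>Automorphisms of rooted trees\<close>

text \<open>Automorphisms are total functions, the identity off \<open>V\<close>, so the inverse
  over the whole type is the group inverse.\<close>

abbreviation iv :: "('a \<Rightarrow> 'a) \<Rightarrow> 'a \<Rightarrow> 'a" where "iv f \<equiv> inv_into UNIV f"

lemma iv_comp_cancel:
  assumes "bij f"
  shows "iv f \<circ> f = id" "f \<circ> iv f = id" "iv f \<circ> (f \<circ> h) = h" "f \<circ> (iv f \<circ> h) = h"
    "bij (iv f)" "iv (iv f) = f"
  using assms
  by (auto simp: fun_eq_iff bij_is_inj bij_is_surj surj_f_inv_f bij_imp_bij_inv inv_inv_eq)

lemma iv_apply [simp]:
  assumes "bij f"
  shows "iv f (f x) = x" "f (iv f x) = x"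
  using assms by (auto simp: bij_is_inj bij_is_surj surj_f_inv_f)

text \<open>A bijection that moves \<open>x\<close> also moves the image of \<open>x\<close>, so the
  other map fixes both points.\<close>

lemma disjoint_support_commute:
  assumes "bij a" "bij b" "\<And>x. a x = x \<or> b x = x"
  shows "a \<circ> b = b \<circ> a"
proof
  fix x
  have inj: "a y = a z \<longleftrightarrow> y = z" "b y = b z \<longleftrightarrow> y = z" for y z
    using assms(1,2) by (auto simp: bij_def inj_eq)
  show "(a \<circ> b) x = (b \<circ> a) x"
    using assms(3)[of x] assms(3)[of "a x"] assms(3)[of "b x"] by (auto simp: inj)
qed

lemma prefix_same_length: "prefix v w \<Longrightarrow> length v = length w \<Longrightarrow> v = w"
  by (auto simp: prefix_def)

lemma prefix_iff_take: "prefix v w \<longleftrightarrow> length v \<le> length w \<and> take (length v) w = v"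
  by (metis append_eq_conv_conj prefix_def prefix_length_le take_is_prefix)

context
  fixes V :: "nat list set"
  assumes tree: "rooted_tree V"
begin

lemma tree_prefix: "w \<in> V \<Longrightarrow> prefix v w \<Longrightarrow> v \<in> V"
  using tree by (auto simp: rooted_tree_def prefix_def)

lemma tree_take: "w \<in> V \<Longrightarrow> take n w \<in> V"
  using tree_prefix take_is_prefix by blast

lemma finite_level: "finite {w \<in> V. length w = n}"
proof (induction n)
  case 0
  then show ?case by (rule finite_subset[of _ "{[]}"]) auto
next
  case (Suc n)
  have "{w \<in> V. length w = Suc n} \<subseteq> (\<Union>v\<in>{w \<in> V. length w = n}. (\<lambda>i. v @ [i]) ` {i. v @ [i] \<in> V})"
  proof
    fix w assume w: "w \<in> {w \<in> V. length w = Suc n}"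
    then have e: "w = butlast w @ [last w]" by (metis (mono_tags) append_butlast_last_id length_0_conv mem_Collect_eq nat.distinct(1))
    have "butlast w \<in> {w \<in> V. length w = n}" using w tree_take[of w n] by (auto simp: butlast_conv_take)
    then show "w \<in> (\<Union>v\<in>{w \<in> V. length w = n}. (\<lambda>i. v @ [i]) ` {i. v @ [i] \<in> V})"
      using w e by (intro UN_I[of "butlast w"] image_eqI[of _ _ "last w"]) auto
  qed
  then show ?case
    by (rule finite_subset) (use Suc tree in \<open>auto simp: rooted_tree_def\<close>)
qed

lemma aut_bij:
  assumes "g \<in> aut V" shows "bij g"
proof -
  have b: "bij_betw g V V" and o: "\<And>x. x \<notin> V \<Longrightarrow> g x = x" using assms by (auto simp: aut_def)
  have "bij_betw g (- V) (- V)"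
    using o by (subst bij_betw_cong[of _ _ id]) (auto simp: bij_betw_id)
  with b have "bij_betw g (V \<union> - V) (V \<union> - V)" by (rule bij_betw_combine) auto
  then show ?thesis by simp
qed

lemma aut_in_iff:
  assumes "g \<in> aut V" shows "g v \<in> V \<longleftrightarrow> v \<in> V"
  using assms by (cases "v \<in> V") (auto simp: aut_def dest: bij_betwE)

lemma aut_prefix_iff:
  assumes "g \<in> aut V" "v \<in> V" "w \<in> V" shows "prefix (g v) (g w) \<longleftrightarrow> prefix v w"
  using assms by (auto simp: aut_def)

text \<open>The order determines the length: it is one less than the number of prefixes.\<close>

lemma aut_length:
  assumes g: "g \<in> aut V" and v: "v \<in> V" shows "length (g v) = length v"
proof -
  have card: "card {x. prefix x w} = Suc (length w)" for w :: "nat list"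
  proof -
    have "{x. prefix x w} = set (prefixes w)" by auto
    then show ?thesis by (simp add: distinct_card)
  qed
  have "g ` {x. prefix x v} = {x. prefix x (g v)}"
  proof (intro subset_antisym subsetI)
    fix x assume x: "x \<in> {x. prefix x (g v)}"
    then have xV: "x \<in> V" using tree_prefix aut_in_iff[OF g] v by blast
    obtain y where y: "x = g y" using aut_bij[OF g] by (metis bij_pointE)
    then have "y \<in> V" using xV aut_in_iff[OF g] by simp
    then show "x \<in> g ` {x. prefix x v}" using x y aut_prefix_iff[OF g] v by auto
  next
    fix x assume "x \<in> g ` {x. prefix x v}"
    then obtain y where y: "x = g y" "prefix y v" by auto
    then have "y \<in> V" using tree_prefix v by blast
    then show "x \<in> {x. prefix x (g v)}" using y aut_prefix_iff[OF g] v by simp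
  qed
  moreover have "inj g" using aut_bij[OF g] by (simp add: bij_is_inj)
  ultimately have "card {x. prefix x (g v)} = card {x. prefix x v}"
    by (metis card_image inj_on_subset subset_UNIV)
  then show ?thesis by (simp add: card)
qed

lemma aut_take:
  assumes g: "g \<in> aut V" and v: "v \<in> V" shows "g (take n v) = take n (g v)"
proof -
  have "prefix (g (take n v)) (g v)"
    using aut_prefix_iff[OF g] v tree_take by (simp add: take_is_prefix)
  then have "take (min (length v) n) (g v) = g (take n v)"
    using aut_length[OF g tree_take[OF v]] by (simp add: prefix_iff_take)
  then show ?thesis using aut_length[OF g v] by (simp add: min_def split: if_splits)
qed

lemma aut_id: "id \<in> aut V"
  by (auto simp: aut_def)

lemma aut_comp:
  assumes "g \<in> aut V" "h \<in> aut V" shows "g \<circ> h \<in> aut V"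
proof -
  have "bij_betw (g \<circ> h) V V" 
    by (rule bij_betw_trans[of _ V V]) (use assms in \<open>unfold aut_def, blast+\<close>)
  moreover have "(g \<circ> h) x = x" if "x \<notin> V" for x
  proof -
    have "h x = x" "g x = x" using assms that unfolding aut_def by blast+
    then show ?thesis by simp
  qed
  moreover have "prefix v w \<longleftrightarrow> prefix ((g \<circ> h) v) ((g \<circ> h) w)" if "v \<in> V" "w \<in> V" for v w
    using that by (simp add: aut_prefix_iff[OF assms(1)] aut_prefix_iff[OF assms(2)] aut_in_iff[OF assms(2)])
  ultimately show ?thesis unfolding aut_def by blast
qed

lemma aut_iv:
  assumes g: "g \<in> aut V" shows "iv g \<in> aut V"
proof -
  have b: "bij g" using aut_bij[OF g] .
  have i: "iv g v \<in> V \<longleftrightarrow> v \<in> V" for v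
    using aut_in_iff[OF g, of "iv g v"] b by simp
  have "bij_betw (iv g) V V"
    by (rule bij_betw_byWitness[where f' = g]) (use b i aut_in_iff[OF g] in auto)
  moreover have "iv g x = x" if "x \<notin> V" for x
    using that g b by (metis (mono_tags, lifting) aut_def iv_apply(1) mem_Collect_eq)
  moreover have "prefix v w \<longleftrightarrow> prefix (iv g v) (iv g w)" if "v \<in> V" "w \<in> V" for v w
    using aut_prefix_iff[OF g, of "iv g v" "iv g w"] that b i by simp
  ultimately show ?thesis unfolding aut_def by blast
qed

lemma group_aut: "group (aut_group V)"
proof (rule groupI)
  fix x assume "x \<in> carrier (aut_group V)"
  then have x: "x \<in> aut V" by (simp add: aut_group_def)
  show "\<exists>y\<in>carrier (aut_group V). y \<otimes>\<^bsub>aut_group V\<^esub> x = \<one>\<^bsub>aut_group V\<^esub>"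
    by (rule bexI[of _ "iv x"])
      (simp_all add: aut_group_def aut_iv[OF x] iv_comp_cancel(1)[OF aut_bij[OF x]])
qed (simp_all add: aut_group_def aut_id aut_comp comp_assoc)

lemma inv_aut_group:
  assumes g: "g \<in> aut V" shows "inv\<^bsub>aut_group V\<^esub> g = iv g"
  by (rule group.inv_equality[OF group_aut])
    (simp_all add: aut_group_def g aut_iv[OF g] iv_comp_cancel(1)[OF aut_bij[OF g]])

end

section \<open>Orbits of rigid stabilizers\<close>

text \<open>A normal form for words in bijections: right-nested, inverses pushed to single letters,
  inverse pairs cancelled. It settles identities that need only free reduction; commutations are
  inserted by hand.\<close>

lemmas bij_group_simps = comp_assoc iv_comp_cancel o_inv_distrib bij_comp

locale branch_group =
  fixes V :: "nat list set" and G :: "(nat list \<Rightarrow> nat list) set"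
  assumes tree: "rooted_tree V"
    and sub: "subgroup G (aut_group V)"
    and level_transitive: "v \<in> V \<Longrightarrow> w \<in> V \<Longrightarrow> length v = length w \<Longrightarrow> \<exists>g\<in>G. g v = w"
    and rist_nontrivial: "v \<in> V \<Longrightarrow> rist V G v \<noteq> {id}"
begin

lemma G_aut: "g \<in> G \<Longrightarrow> g \<in> aut V"
  using subgroup.subset[OF sub] by (auto simp: aut_group_def)

lemma G_bij: "g \<in> G \<Longrightarrow> bij g"
  using G_aut aut_bij[OF tree] by blast

lemma G_id: "id \<in> G"
  using subgroup.one_closed[OF sub] by (simp add: aut_group_def)

lemma G_comp: "g \<in> G \<Longrightarrow> h \<in> G \<Longrightarrow> g \<circ> h \<in> G"
  using subgroup.m_closed[OF sub] by (simp add: aut_group_def)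

lemma G_iv: "g \<in> G \<Longrightarrow> iv g \<in> G"
  using subgroup.m_inv_closed[OF sub] inv_aut_group[OF tree] G_aut by metis

lemma G_in_iff: "g \<in> G \<Longrightarrow> g v \<in> V \<longleftrightarrow> v \<in> V"
  using aut_in_iff[OF tree G_aut] .

lemma G_length: "g \<in> G \<Longrightarrow> v \<in> V \<Longrightarrow> length (g v) = length v"
  using aut_length[OF tree G_aut] .

lemma G_take: "g \<in> G \<Longrightarrow> v \<in> V \<Longrightarrow> g (take n v) = take n (g v)"
  using aut_take[OF tree G_aut] .

lemma G_prefix_iff: "g \<in> G \<Longrightarrow> v \<in> V \<Longrightarrow> w \<in> V \<Longrightarrow> prefix (g v) (g w) \<longleftrightarrow> prefix v w"
  using aut_prefix_iff[OF tree G_aut] .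

lemma G_inj: "g \<in> G \<Longrightarrow> g x = g y \<longleftrightarrow> x = y"
  using G_bij by (auto simp: bij_def inj_eq)

lemma G_outside: "g \<in> G \<Longrightarrow> x \<notin> V \<Longrightarrow> g x = x"
  using G_aut unfolding aut_def by blast

text \<open>Elements of \<open>G\<close> are the identity off \<open>V\<close>, so membership
  becomes a condition on the support, the form suited to disjointness arguments.\<close>

lemma rist_iff: "g \<in> rist V G v \<longleftrightarrow> g \<in> G \<and> (\<forall>x. g x \<noteq> x \<longrightarrow> x \<in> V \<and> prefix v x)"
  using G_outside by (auto simp: rist_def subtree_def)

lemma rist_G: "g \<in> rist V G v \<Longrightarrow> g \<in> G"
  by (simp add: rist_iff)

lemma rist_bij: "g \<in> rist V G v \<Longrightarrow> bij g"
  using rist_G G_bij by blast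

lemma rist_fixes: "g \<in> rist V G v \<Longrightarrow> \<not> prefix v x \<Longrightarrow> g x = x"
  by (auto simp: rist_iff)

lemma rist_id: "id \<in> rist V G v"
  by (simp add: rist_iff G_id)

lemma rist_comp:
  assumes "g \<in> rist V G v" "h \<in> rist V G v" shows "g \<circ> h \<in> rist V G v"
proof -
  have "x \<in> V \<and> prefix v x" if "(g \<circ> h) x \<noteq> x" for x
    using assms that unfolding rist_iff by (cases "h x = x") auto
  then show ?thesis using assms G_comp by (simp add: rist_iff)
qed

lemma rist_iv:
  assumes "g \<in> rist V G v" shows "iv g \<in> rist V G v"
proof -
  have "x \<in> V \<and> prefix v x" if "iv g x \<noteq> x" for x
    using assms that iv_apply(1)[OF rist_bij[OF assms], of x] unfolding rist_iff by metis
  then show ?thesis using assms G_iv by (simp add: rist_iff)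
qed

lemma rist_mono:
  assumes "prefix v w" shows "rist V G w \<subseteq> rist V G v"
proof
  fix g assume "g \<in> rist V G w"
  moreover have "prefix w x \<Longrightarrow> prefix v x" for x using assms by (rule prefix_order.trans)
  ultimately show "g \<in> rist V G v" unfolding rist_iff by blast
qed

text \<open>If moved, \<open>v\<close> would go to another vertex of its level, which is not below
  \<open>v\<close> and hence fixed, against injectivity.\<close>

lemma rist_root:
  assumes g: "g \<in> rist V G v" and v: "v \<in> V" shows "g v = v"
proof (rule ccontr)
  assume ne: "g v \<noteq> v"
  have "length (g v) = length v" using G_length[OF rist_G[OF g] v] .
  then have "\<not> prefix v (g v)" using ne prefix_same_length by metis
  then have "g (g v) = g v" by (rule rist_fixes[OF g])
  then show False using ne G_inj[OF rist_G[OF g]] by blast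
qed

lemma rist_prefix_iff:
  assumes "g \<in> rist V G v" "v \<in> V" "x \<in> V" shows "prefix v (g x) \<longleftrightarrow> prefix v x"
  using G_prefix_iff[OF rist_G[OF assms(1)] assms(2,3)] rist_root[OF assms(1,2)] by simp

lemma rist_conj:
  assumes f: "f \<in> G" and g: "g \<in> rist V G v" and v: "v \<in> V"
  shows "f \<circ> g \<circ> iv f \<in> rist V G (f v)"
proof -
  have b: "bij f" using G_bij[OF f] .
  have "x \<in> V \<and> prefix (f v) x" if "(f \<circ> g \<circ> iv f) x \<noteq> x" for x
  proof -
    have "g (iv f x) \<noteq> iv f x" using that b by auto
    then have i: "iv f x \<in> V" "prefix v (iv f x)" using g by (auto simp: rist_iff)
    then have "x \<in> V" using G_in_iff[OF f, of "iv f x"] b by simp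
    then show ?thesis using G_prefix_iff[OF f v i(1)] i b by simp
  qed
  then show ?thesis using G_comp G_iv f rist_G[OF g] by (auto simp: rist_iff)
qed

lemma rist_commute:
  assumes a: "a \<in> rist V G v" and b: "b \<in> rist V G w" and "\<not> prefix v w" "\<not> prefix w v"
  shows "a \<circ> b = b \<circ> a"
proof (rule disjoint_support_commute)
  show "a x = x \<or> b x = x" for x
    using a b assms(3,4) prefix_same_cases unfolding rist_iff by metis
qed (use a b rist_bij in auto)

lemma rist_commute_level:
  assumes "a \<in> rist V G v" "b \<in> rist V G w" "length v = length w" "v \<noteq> w"
  shows "a \<circ> b = b \<circ> a"
  using rist_commute[OF assms(1,2)] assms(3,4) prefix_same_length by metis

lemma finite_rist_orbit:
  assumes "z \<in> V" shows "finite ((\<lambda>g. g z) ` rist V G u)"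
  by (rule finite_subset[OF _ finite_level[OF tree, of "length z"]])
    (use assms G_length G_in_iff rist_G in auto)

text \<open>An \<open>f\<close> fixing \<open>u\<close> normalizes \<open>rist V G u\<close>. One
  inclusion is shown for all such \<open>f\<close>; applied to \<open>iv f\<close> it gives the
  other.\<close>

lemma rist_orbit_conj:
  assumes f: "f \<in> G" and fu: "f u = u" and u: "u \<in> V"
  shows "(\<lambda>g. g (f z)) ` rist V G u = f ` (\<lambda>g. g z) ` rist V G u"
proof -
  have sub: "(\<lambda>g. g (f z)) ` rist V G u \<subseteq> f ` (\<lambda>g. g z) ` rist V G u" if f: "f \<in> G" and fu: "f u = u" for f z
  proof
    fix x assume "x \<in> (\<lambda>g. g (f z)) ` rist V G u"
    then obtain g where g: "g \<in> rist V G u" "x = g (f z)" by auto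
    have b: "bij f" using G_bij[OF f] .
    have "iv f u = u" using fu b by (metis iv_apply(1))
    then have "iv f \<circ> g \<circ> f \<in> rist V G u" using rist_conj[OF G_iv[OF f] g(1) u] b by (simp add: iv_comp_cancel)
    moreover have "x = f ((iv f \<circ> g \<circ> f) z)" using g b by simp
    ultimately show "x \<in> f ` (\<lambda>g. g z) ` rist V G u" by blast
  qed
  have b: "bij f" using G_bij[OF f] .
  have "iv f u = u" using fu b by (metis iv_apply(1))
  from sub[OF G_iv[OF f] this, of "f z"]
  have "(\<lambda>g. g z) ` rist V G u \<subseteq> iv f ` (\<lambda>g. g (f z)) ` rist V G u" using b by simp
  then have "f ` (\<lambda>g. g z) ` rist V G u \<subseteq> f ` iv f ` (\<lambda>g. g (f z)) ` rist V G u" by blast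
  also have "\<dots> = (\<lambda>g. g (f z)) ` rist V G u" using b by (simp add: image_comp comp_def)
  finally show ?thesis using sub[OF f fu] by blast
qed

lemma rist_moves:
  assumes "v \<in> V" obtains g x where "g \<in> rist V G v" "x \<in> V" "prefix v x" "g x \<noteq> x"
proof -
  obtain g where g: "g \<in> rist V G v" "g \<noteq> id" using rist_nontrivial[OF assms] rist_id by blast
  then obtain x where "g x \<noteq> x" by (auto simp: fun_eq_iff)
  then show ?thesis using that g unfolding rist_iff by blast
qed

lemma card_rist_orbit_take:
  assumes u: "u \<in> V" and z: "z \<in> V"
  shows "card ((\<lambda>g. g (take l z)) ` rist V G u) \<le> card ((\<lambda>g. g z) ` rist V G u)"
proof -
  have "(\<lambda>g. g (take l z)) ` rist V G u = take l ` (\<lambda>g. g z) ` rist V G u"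
    using G_take[OF rist_G z] by (auto simp: image_image)
  then show ?thesis using card_image_le[OF finite_rist_orbit[OF z]] by metis
qed

text \<open>An orbit on level \<open>l\<close> grows strictly at a deeper level where some element of the rigid stabilizer
  of one of its points acts nontrivially; the stabilizer of \<open>u\<close> in \<open>G\<close> is transitive on the vertices of a given level
  below \<open>u\<close> and normalizes the rigid stabilizer, so the growth occurs for all orbits at once.\<close>

lemma rist_orbits_large:
  assumes u: "u \<in> V"
  shows "\<exists>l\<ge>length u. \<forall>z\<in>V. prefix u z \<and> l \<le> length z \<longrightarrow> n \<le> card ((\<lambda>g. g z) ` rist V G u)"
proof -
  have "\<exists>l\<ge>length u. \<forall>z\<in>V. prefix u z \<and> length z = l \<longrightarrow> n \<le> card ((\<lambda>g. g z) ` rist V G u)"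
  proof (induction n)
    case (Suc n)
    then obtain l where l: "l \<ge> length u"
      "\<And>z. z \<in> V \<Longrightarrow> prefix u z \<Longrightarrow> length z = l \<Longrightarrow> n \<le> card ((\<lambda>g. g z) ` rist V G u)" by blast
    show ?case
    proof (cases "\<exists>z\<in>V. prefix u z \<and> length z = l")
      case True
      then obtain z where z: "z \<in> V" "prefix u z" "length z = l" by blast
      obtain g x where g: "g \<in> rist V G z" and x: "x \<in> V" "prefix z x" "g x \<noteq> x"
        using rist_moves[OF z(1)] by blast
      have ux: "prefix u x" using z x by (meson prefix_order.trans)
      have tx: "take l x = z" using x z by (auto simp: prefix_iff_take)
      have gu: "g \<in> rist V G u" using rist_mono[OF z(2)] g by blast
      let ?O = "(\<lambda>g. g x) ` rist V G u"
      have fin: "finite ?O" using finite_rist_orbit[OF x(1)] .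
      \<comment> \<open>Dropping \<open>g x\<close> loses nothing at level \<open>l\<close>: it has
        the same truncation \<open>z\<close> as \<open>x\<close>, which stays.\<close>
      have im: "take l ` (?O - {g x}) = (\<lambda>g. g z) ` rist V G u"
      proof -
        have O: "take l ` ?O = (\<lambda>g. g z) ` rist V G u"
          using G_take[OF rist_G x(1)] tx by (auto simp: image_image)
        have diff: "f ` A = f ` (A - {a})" if "f a \<in> f ` (A - {a})" for f :: "nat list \<Rightarrow> nat list" and a A
          using that by blast
        have "take l (g x) = take l x"
          using G_take[OF rist_G[OF g] x(1), of l, symmetric] tx rist_root[OF g z(1)] by simp
        moreover have "x \<in> ?O" using rist_id[of u] by (metis id_apply image_eqI)
        ultimately have "take l (g x) \<in> take l ` (?O - {g x})" using x(3) by (metis Diff_iff imageI singletonD)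
        from diff[OF this] show ?thesis using O by simp
      qed
      have "n \<le> card ((\<lambda>g. g z) ` rist V G u)" using l z by blast
      also have "\<dots> \<le> card (?O - {g x})" using im card_image_le[of "?O - {g x}" "take l"] fin by simp
      also have "\<dots> < card ?O" using fin gu by (intro psubset_card_mono) auto
      finally have cx: "Suc n \<le> card ?O" by simp
      have "Suc n \<le> card ((\<lambda>g. g y) ` rist V G u)" if y: "y \<in> V" "prefix u y" "length y = length x" for y
      proof -
        obtain f where f: "f \<in> G" "f x = y" using level_transitive[OF x(1) y(1)] y(3) by auto
        have "f u = u"
          using G_take[OF f(1) x(1), of "length u"] ux y(2) f(2) by (simp add: prefix_iff_take)
        from rist_orbit_conj[OF f(1) this u, of x]
        have "card ((\<lambda>g. g y) ` rist V G u) = card ?O"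
          using f by (metis card_image G_bij bij_is_inj inj_on_subset subset_UNIV)
        then show ?thesis using cx by simp
      qed
      moreover have "length x \<ge> length u" using ux by (simp add: prefix_length_le)
      ultimately show ?thesis by blast
    qed (use l in blast)
  qed auto
  then obtain l where l: "l \<ge> length u"
      "\<And>z. z \<in> V \<Longrightarrow> prefix u z \<Longrightarrow> length z = l \<Longrightarrow> n \<le> card ((\<lambda>g. g z) ` rist V G u)" by blast
  have "n \<le> card ((\<lambda>g. g z) ` rist V G u)" if z: "z \<in> V" "prefix u z" "l \<le> length z" for z
  proof -
    have "prefix u (take l z)" using z l(1) by (simp add: prefix_iff_take min_def)
    then have "n \<le> card ((\<lambda>g. g (take l z)) ` rist V G u)"
      using z l(2)[of "take l z"] tree_take[OF tree] by simp
    then show ?thesis using card_rist_orbit_take[OF u z(1), of l] by simp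
  qed
  then show ?thesis using l(1) by blast
qed

text \<open>Trades orbit points for group elements with distinct values at \<open>z\<close>, the
  objects to which the pigeonhole arguments apply.\<close>

lemma rist_orbit_transversal:
  assumes "n \<le> card ((\<lambda>g. g z) ` rist V G u)"
  obtains A where "A \<subseteq> rist V G u" "finite A" "card A = n" "inj_on (\<lambda>g. g z) A"
proof -
  obtain Z where Z: "Z \<subseteq> (\<lambda>g. g z) ` rist V G u" "card Z = n" "finite Z"
    using assms by (meson obtain_subset_with_card_n)
  then obtain A where A: "A \<subseteq> rist V G u" "inj_on (\<lambda>g. g z) A" "Z = (\<lambda>g. g z) ` A"
    by (meson subset_image_inj)
  then show ?thesis using that[OF A(1)] Z by (metis card_image finite_imageD)
qed

end

section \<open>Derived rigid stabilizers in confined subgroups\<close>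

primrec comp_upto :: "(nat \<Rightarrow> 'a \<Rightarrow> 'a) \<Rightarrow> nat \<Rightarrow> 'a \<Rightarrow> 'a" where
  "comp_upto e 0 = id"
| "comp_upto e (Suc n) = comp_upto e n \<circ> e n"

text \<open>The quotient of two partial products is the product of
  \<open>e s, ..., e (t - 1)\<close>. Its first factor is split off; the rest \<open>q\<close> moves
  only points moved by a later factor.\<close>

lemma comp_upto_split:
  assumes "s < t"
  shows "\<exists>q. comp_upto e t = comp_upto e s \<circ> (e s \<circ> q)
    \<and> (\<forall>x. q x \<noteq> x \<longrightarrow> (\<exists>i. s < i \<and> i < t \<and> e i x \<noteq> x))"
  using assms
proof (induction t)
  case (Suc t)
  show ?case
  proof (cases "s = t")
    case True
    then show ?thesis by (intro exI[of _ id]) simp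
  next
    case False
    with Suc obtain q where q: "comp_upto e t = comp_upto e s \<circ> (e s \<circ> q)"
      "\<And>x. q x \<noteq> x \<Longrightarrow> \<exists>i. s < i \<and> i < t \<and> e i x \<noteq> x"
      by (metis less_SucE)
    have "\<exists>i. s < i \<and> i < Suc t \<and> e i x \<noteq> x" if "(q \<circ> e t) x \<noteq> x" for x
    proof (cases "e t x = x")
      case True
      then have "q x \<noteq> x" using that by simp
      then show ?thesis using q(2) less_SucI by blast
    next
      case neq: False
      have "s < t" using Suc.prems False by simp
      then show ?thesis using neq by blast
    qed
    moreover have "comp_upto e (Suc t) = comp_upto e s \<circ> (e s \<circ> (q \<circ> e t))"
      by (simp add: q(1) comp_assoc)
    ultimately show ?thesis by blast
  qed
qed simp

text \<open>\<open>col\<close> picks, for each \<open>g\<close> in the rigid stabilizer of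
  \<open>u\<close>, one of finitely many elements whose conjugate by \<open>g\<close> lies in
  \<open>H\<close>. As these move \<open>u\<close> within its level, they conjugate
  \<open>rist V G u\<close> to a group commuting with it elementwise.\<close>

locale confined_subgroup = branch_group V G
  for V :: "nat list set" and G :: "(nat list \<Rightarrow> nat list) set" +
  fixes H :: "(nat list \<Rightarrow> nat list) set" and u :: "nat list"
    and P :: "(nat list \<Rightarrow> nat list) set" and col :: "(nat list \<Rightarrow> nat list) \<Rightarrow> (nat list \<Rightarrow> nat list)"
  assumes u_in: "u \<in> V"
    and H_sub: "H \<subseteq> G"
    and H_comp: "g \<in> H \<Longrightarrow> h \<in> H \<Longrightarrow> g \<circ> h \<in> H"
    and H_iv: "g \<in> H \<Longrightarrow> iv g \<in> H"
    and finite_P: "finite P"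
    and P_sub: "P \<subseteq> G"
    and P_moves: "p \<in> P \<Longrightarrow> p u \<noteq> u"
    and col_P: "g \<in> rist V G u \<Longrightarrow> col g \<in> P"
    and col_H: "g \<in> rist V G u \<Longrightarrow> iv g \<circ> col g \<circ> g \<in> H"
begin

definition N where "N = rist V G u \<inter> H"

text \<open>The normalizer of \<open>N\<close> in \<open>rist V G u\<close>. Both inclusions are
  required, since for infinite \<open>N\<close> one does not imply the other.\<close>

definition L where "L = {g \<in> rist V G u. \<forall>n\<in>N. g \<circ> n \<circ> iv g \<in> N \<and> iv g \<circ> n \<circ> g \<in> N}"

lemma N_rist: "n \<in> N \<Longrightarrow> n \<in> rist V G u"
  by (simp add: N_def)

lemma N_comp: "m \<in> N \<Longrightarrow> n \<in> N \<Longrightarrow> m \<circ> n \<in> N"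
  by (simp add: N_def rist_comp H_comp)

lemma N_iv: "n \<in> N \<Longrightarrow> iv n \<in> N"
  by (simp add: N_def rist_iv H_iv)

lemma L_rist: "g \<in> L \<Longrightarrow> g \<in> rist V G u"
  by (simp add: L_def)

lemma L_conj: "g \<in> L \<Longrightarrow> n \<in> N \<Longrightarrow> g \<circ> n \<circ> iv g \<in> N"
  by (simp add: L_def)

lemma L_conj_iv: "g \<in> L \<Longrightarrow> n \<in> N \<Longrightarrow> iv g \<circ> n \<circ> g \<in> N"
  by (simp add: L_def)

lemma col_bij: "g \<in> rist V G u \<Longrightarrow> bij (col g)"
  using col_P P_sub G_bij by blast

lemma col_G: "g \<in> rist V G u \<Longrightarrow> col g \<in> G"
  using col_P P_sub by blast

text \<open>If \<open>g\<close> and \<open>g'\<close> have colour \<open>p\<close>, the quotient of the two corresponding elements of \<open>H\<close> is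
  \<open>g\<^sup>-\<^sup>1 g'\<close> times an element of the rigid stabilizer of \<open>p u\<close>, and the latter commutes with \<open>N\<close>.\<close>

lemma same_colour_conj:
  assumes g: "g \<in> rist V G u" and g': "g' \<in> rist V G u" and same: "col g = col g'" and n: "n \<in> N"
  shows "iv g \<circ> g' \<circ> n \<circ> (iv g' \<circ> g) \<in> N"
proof -
  define p where "p = col g"
  have p: "p \<in> G" "bij p" "p u \<noteq> u" using col_G[OF g] col_bij[OF g] P_moves[OF col_P[OF g]] by (auto simp: p_def)
  have pV: "p u \<in> V" "length (p u) = length u" using G_in_iff[OF p(1)] G_length[OF p(1)] u_in by auto
  have nR: "n \<in> rist V G u" "n \<in> H" using n by (auto simp: N_def)
  note b = p(2) rist_bij[OF g] rist_bij[OF g'] rist_bij[OF nR(1)]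
  define d where "d = iv g \<circ> g'"
  define q where "q = iv g' \<circ> (p \<circ> (g \<circ> iv g') \<circ> iv p) \<circ> iv (iv g')"
  have bd: "bij d" "bij q" using b by (auto simp: d_def q_def bij_group_simps)
  \<comment> \<open>\<open>p u\<close> is another vertex of the level of \<open>u\<close>, so the
    rigid stabilizer of \<open>u\<close> fixes it; this keeps \<open>q\<close> in the rigid
    stabilizer of \<open>p u\<close>.\<close>
  have "iv g' (p u) = p u"
    using rist_fixes[OF rist_iv[OF g']] pV p(3) prefix_same_length by metis
  then have q: "q \<in> rist V G (p u)"
    using rist_conj[OF G_iv[OF rist_G[OF g']] rist_conj[OF p(1) rist_comp[OF g rist_iv[OF g']] u_in] pV(1)]
    by (simp add: q_def)
  have qn: "q \<circ> n = n \<circ> q"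
    using rist_commute_level[OF q nR(1) pV(2) p(3)] .
  have "(iv g \<circ> p \<circ> g) \<circ> iv (iv g' \<circ> p \<circ> g') \<in> H"
    using H_comp[OF col_H[OF g] H_iv[OF col_H[OF g']]] same by (simp add: p_def)
  moreover have "(iv g \<circ> p \<circ> g) \<circ> iv (iv g' \<circ> p \<circ> g') = d \<circ> q"
    using b by (simp add: d_def q_def bij_group_simps)
  ultimately have dq: "d \<circ> q \<in> H" by simp
  then have "(d \<circ> q) \<circ> n \<circ> iv (d \<circ> q) \<in> H" using H_comp H_iv nR(2) by blast
  moreover have "(d \<circ> q) \<circ> n \<circ> iv (d \<circ> q) = d \<circ> (q \<circ> n) \<circ> iv q \<circ> iv d"
    using b bd by (simp add: bij_group_simps)
  moreover have "\<dots> = d \<circ> n \<circ> iv d" unfolding qn using b bd by (simp add: bij_group_simps)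
  moreover have "\<dots> = iv g \<circ> g' \<circ> n \<circ> (iv g' \<circ> g)" using b by (simp add: d_def bij_group_simps)
  ultimately have "iv g \<circ> g' \<circ> n \<circ> (iv g' \<circ> g) \<in> H" by simp
  then show ?thesis
    using g g' nR(1) by (simp add: N_def rist_comp rist_iv)
qed

lemma same_colour_normalizes:
  assumes g: "g \<in> rist V G u" and g': "g' \<in> rist V G u" and same: "col g = col g'"
  shows "iv g \<circ> g' \<in> L"
proof -
  have "iv (iv g \<circ> g') = iv g' \<circ> g"
    using rist_bij[OF g] rist_bij[OF g'] by (simp add: bij_group_simps)
  then show ?thesis
    using same_colour_conj[OF g g' same] same_colour_conj[OF g' g same[symmetric]] g g'
    by (simp add: L_def rist_comp rist_iv)
qed

text \<open>For \<open>h = g\<^sup>-\<^sup>1 p g\<close>, equality of colours puts \<open>x\<^sup>-\<^sup>1 (h x h\<^sup>-\<^sup>1)\<close> in \<open>H\<close> for \<open>x = k, l, k l\<close>. The second factors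
  commute with \<open>rist u\<close> and multiply homomorphically, so they cancel.\<close>

lemma monochromatic_commutator:
  assumes g: "g \<in> rist V G u" and k: "k \<in> rist V G u" and l: "l \<in> rist V G u"
    and c: "col (g \<circ> k) = col g" "col (g \<circ> l) = col g" "col (g \<circ> (k \<circ> l)) = col g"
  shows "iv k \<circ> iv l \<circ> k \<circ> l \<in> N"
proof -
  define p where "p = col g"
  have p: "p \<in> G" "bij p" "p u \<noteq> u" using col_G[OF g] col_bij[OF g] P_moves[OF col_P[OF g]] by (auto simp: p_def)
  define h where "h = iv g \<circ> p \<circ> g"
  have hH: "h \<in> H" using col_H[OF g] by (simp add: h_def p_def)
  then have hG: "h \<in> G" using H_sub by blast
  have bh: "bij h" using G_bij[OF hG] .
  note b = rist_bij[OF g] rist_bij[OF k] rist_bij[OF l] bh p(2)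
  \<comment> \<open>\<open>g\<close> fixes \<open>u\<close>, so the conjugate \<open>h\<close> of
    \<open>p\<close> still moves it.\<close>
  have hu: "h u \<noteq> u"
  proof
    assume "h u = u"
    then have "g (iv g (p (g u))) = g u" by (simp add: h_def)
    then show False using b rist_root[OF g u_in] p(3) by simp
  qed
  have hl: "length (h u) = length u" using G_length[OF hG u_in] .
  define K where "K = h \<circ> k \<circ> iv h"
  define K' where "K' = h \<circ> l \<circ> iv h"
  have bK: "bij K" "bij K'" using b by (auto simp: K_def K'_def bij_group_simps)
  have K: "K \<in> rist V G (h u)" using rist_conj[OF hG k u_in] by (simp add: K_def)
  have Kl: "K \<circ> iv l = iv l \<circ> K" using rist_commute_level[OF K rist_iv[OF l] hl hu] .
  have el: "iv x \<circ> (h \<circ> x \<circ> iv h) \<in> H" if x: "x \<in> rist V G u" "col (g \<circ> x) = col g" for x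
  proof -
    have "(iv (g \<circ> x) \<circ> p \<circ> (g \<circ> x)) \<circ> iv h \<in> H"
      using H_comp[OF col_H[OF rist_comp[OF g x(1)]] H_iv[OF hH]] x by (simp add: p_def)
    moreover have "(iv (g \<circ> x) \<circ> p \<circ> (g \<circ> x)) \<circ> iv h = iv x \<circ> (h \<circ> x \<circ> iv h)"
      using b rist_bij[OF x(1)] by (simp add: h_def bij_group_simps)
    ultimately show ?thesis by simp
  qed
  have "iv k \<circ> K \<in> H" "iv l \<circ> K' \<in> H" using el[OF k c(1)] el[OF l c(2)] by (simp_all add: K_def K'_def)
  moreover have "iv (k \<circ> l) \<circ> (K \<circ> K') \<in> H"
    using el[OF rist_comp[OF k l] c(3)] b by (simp add: K_def K'_def bij_group_simps)
  ultimately have "(iv k \<circ> K) \<circ> (iv l \<circ> K') \<circ> iv (iv (k \<circ> l) \<circ> (K \<circ> K')) \<in> H" using H_comp H_iv by blast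
  moreover have "(iv k \<circ> K) \<circ> (iv l \<circ> K') \<circ> iv (iv (k \<circ> l) \<circ> (K \<circ> K')) = iv k \<circ> (K \<circ> iv l) \<circ> iv K \<circ> k \<circ> l"
    using b bK by (simp add: bij_group_simps)
  moreover have "\<dots> = iv k \<circ> iv l \<circ> k \<circ> l" unfolding Kl using b bK by (simp add: bij_group_simps)
  ultimately have "iv k \<circ> iv l \<circ> k \<circ> l \<in> H" by simp
  then show ?thesis using k l by (simp add: N_def rist_comp rist_iv)
qed

text \<open>The double commutator trick: \<open>[[n, A]\<^sup>-\<^sup>1, B] = [A, B]\<close> because \<open>n A n\<^sup>-\<^sup>1\<close> commutes with \<open>A\<close> and \<open>B\<close>.\<close>

lemma normalizer_commutator:
  assumes n: "n \<in> N" and w: "w \<in> V" and nw: "n w \<noteq> w"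
    and A: "A \<in> L" "A \<in> rist V G w" and B: "B \<in> L" "B \<in> rist V G w"
  shows "A \<circ> B \<circ> iv A \<circ> iv B \<in> N"
proof -
  have nG: "n \<in> G" using rist_G[OF N_rist[OF n]] .
  note b = G_bij[OF nG] rist_bij[OF A(2)] rist_bij[OF B(2)]
  define C where "C = n \<circ> A \<circ> iv n"
  have bC: "bij C" using b by (simp add: C_def bij_group_simps)
  have "C \<in> rist V G (n w)" using rist_conj[OF nG A(2) w] by (simp add: C_def)
  then have CB: "B \<circ> C = C \<circ> B"
    using rist_commute_level[OF _ B(2) G_length[OF nG w] nw] by metis
  \<comment> \<open>The commutator of \<open>n\<close> and \<open>A\<close>, read as
    \<open>n\<close> times a conjugate of its inverse by an element of \<open>L\<close>.\<close>
  have "n \<circ> (A \<circ> iv n \<circ> iv A) \<in> N" using N_comp[OF n L_conj[OF A(1) N_iv[OF n]]] .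
  then have XN: "C \<circ> iv A \<in> N" using b by (simp add: C_def bij_group_simps)
  have "iv (C \<circ> iv A) \<circ> (B \<circ> (C \<circ> iv A) \<circ> iv B) \<in> N"
    using N_comp[OF N_iv[OF XN] L_conj[OF B(1) XN]] .
  moreover have "iv (C \<circ> iv A) \<circ> (B \<circ> (C \<circ> iv A) \<circ> iv B) = A \<circ> iv C \<circ> (B \<circ> C) \<circ> iv A \<circ> iv B"
    using b bC by (simp add: bij_group_simps)
  moreover have "\<dots> = A \<circ> B \<circ> iv A \<circ> iv B" unfolding CB using b bC by (simp add: bij_group_simps)
  ultimately show ?thesis by simp
qed

text \<open>Of the \<open>card P + 1\<close> partial products two share a colour, so by
  \<open>same_colour_normalizes\<close> their quotient lies in \<open>L\<close>. The support bound
  on \<open>q\<close> later separates it from other factors.\<close>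

lemma exists_interval_in_L:
  assumes e: "\<And>i. i < card P \<Longrightarrow> e i \<in> rist V G u"
  shows "\<exists>s<card P. \<exists>q\<in>G. e s \<circ> q \<in> L \<and> (\<forall>x. q x \<noteq> x \<longrightarrow> (\<exists>i. s < i \<and> i < card P \<and> e i x \<noteq> x))"
proof -
  have prR: "comp_upto e s \<in> rist V G u" if "s \<le> card P" for s
    using that by (induction s) (simp_all add: rist_id rist_comp e)
  have "\<not> inj_on (\<lambda>s. col (comp_upto e s)) {..card P}"
  proof (rule pigeonhole)
    have "card ((\<lambda>s. col (comp_upto e s)) ` {..card P}) \<le> card P"
      by (rule card_mono[OF finite_P]) (use prR col_P in auto)
    then show "card ((\<lambda>s. col (comp_upto e s)) ` {..card P}) < card {..card P}" by simp
  qed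
  then obtain i j where ij: "i \<le> card P" "j \<le> card P" "i \<noteq> j" "col (comp_upto e i) = col (comp_upto e j)"
    by (auto simp: inj_on_def)
  obtain s t where st: "s < t" "t \<le> card P" "col (comp_upto e s) = col (comp_upto e t)"
  proof (cases "i < j")
    case True
    then show ?thesis using that[of i j] ij by simp
  next
    case False
    then show ?thesis using that[of j i] ij by simp
  qed
  obtain q where q: "comp_upto e t = comp_upto e s \<circ> (e s \<circ> q)"
    "\<And>x. q x \<noteq> x \<Longrightarrow> \<exists>i. s < i \<and> i < t \<and> e i x \<noteq> x"
    using comp_upto_split[OF st(1), of e] by (elim exE conjE) (rule that, assumption, simp)
  have s: "s < card P" using st by simp
  have sR: "comp_upto e s \<in> rist V G u" and tR: "comp_upto e t \<in> rist V G u" using prR st by auto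
  have "iv (comp_upto e s) \<circ> comp_upto e t = e s \<circ> q"
    using q(1) rist_bij[OF sR] by (simp add: bij_group_simps)
  then have L: "e s \<circ> q \<in> L" using same_colour_normalizes[OF sR tR st(3)] by simp
  have "iv (e s) \<circ> (e s \<circ> q) \<in> G" using G_comp G_iv rist_G L_rist[OF L] rist_G[OF e[OF s]] by blast
  then have "q \<in> G" using rist_bij[OF e[OF s]] by (simp add: bij_group_simps)
  moreover have "\<exists>i. s < i \<and> i < card P \<and> e i x \<noteq> x" if "q x \<noteq> x" for x
    using q(2)[OF that] st(2) by (meson less_le_trans)
  ultimately show ?thesis using s L by blast
qed

text \<open>Two pigeonholes give a square: \<open>x\<close>, \<open>x'\<close> with different values
  at \<open>w\<close>, and \<open>y\<close>, \<open>y'\<close> in \<open>rist V G w\<close> with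
  different values at \<open>z\<close>, such that the four products have one colour. Then
  \<open>monochromatic_commutator\<close> applies with base \<open>x \<circ> y\<close>.\<close>

lemma N_moves:
  assumes w: "w \<in> V" "prefix u w" and z: "z \<in> V" "prefix w z"
    and cw: "card P + 1 \<le> card ((\<lambda>g. g w) ` rist V G u)"
    and cz: "(card P + 1) * (card P + 1) * card P + 1 \<le> card ((\<lambda>g. g z) ` rist V G w)"
  shows "\<exists>n\<in>N. n z \<noteq> z"
proof -
  obtain S where S: "S \<subseteq> rist V G u" "finite S" "card S = card P + 1" "inj_on (\<lambda>g. g w) S"
    using rist_orbit_transversal[OF cw] .
  obtain T where T: "T \<subseteq> rist V G w" "finite T" "card T = (card P + 1) * (card P + 1) * card P + 1" "inj_on (\<lambda>g. g z) T"
    using rist_orbit_transversal[OF cz] .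
  have TR: "T \<subseteq> rist V G u" using T(1) rist_mono[OF w(2)] by blast
  have "\<exists>x\<in>S. \<exists>x'\<in>S. x \<noteq> x' \<and> col (x \<circ> y) = col (x' \<circ> y)" if y: "y \<in> T" for y
  proof -
    have "\<not> inj_on (\<lambda>x. col (x \<circ> y)) S"
    proof (rule pigeonhole)
      have "card ((\<lambda>x. col (x \<circ> y)) ` S) \<le> card P"
        by (rule card_mono[OF finite_P]) (use S(1) TR y col_P rist_comp in blast)
      then show "card ((\<lambda>x. col (x \<circ> y)) ` S) < card S" using S(3) by simp
    qed
    then show ?thesis by (auto simp: inj_on_def)
  qed
  then obtain f f' where f: "\<And>y. y \<in> T \<Longrightarrow> f y \<in> S \<and> f' y \<in> S \<and> f y \<noteq> f' y \<and> col (f y \<circ> y) = col (f' y \<circ> y)"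
    by metis
  \<comment> \<open>The pair chosen for \<open>y\<close> and the common colour take at most
    \<open>(card P + 1) * (card P + 1) * card P\<close> values, fewer than \<open>T\<close> has
    elements.\<close>
  let ?c = "\<lambda>y. (f y, f' y, col (f y \<circ> y))"
  have "\<not> inj_on ?c T"
  proof (rule pigeonhole)
    have "card (?c ` T) \<le> card (S \<times> S \<times> P)"
    proof (rule card_mono)
      show "finite (S \<times> S \<times> P)" using S(2) finite_P by simp
      have "col (f y \<circ> y) \<in> P" if "y \<in> T" for y
        using col_P rist_comp f[OF that] S(1) TR that by blast
      then show "?c ` T \<subseteq> S \<times> S \<times> P" using f by auto
    qed
    then show "card (?c ` T) < card T" using S(3) T(3) by (simp add: card_cartesian_product algebra_simps)
  qed
  then obtain y y' where y: "y \<in> T" "y' \<in> T" "y \<noteq> y'" "f y = f y'" "f' y = f' y'" "col (f y \<circ> y) = col (f y' \<circ> y')"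
    by (auto simp: inj_on_def)
  define x where "x = f y"
  define x' where "x' = f' y"
  have x: "x \<in> S" "x' \<in> S" "x \<noteq> x'" using f y by (auto simp: x_def x'_def)
  have xR: "x \<in> rist V G u" "x' \<in> rist V G u" "y \<in> rist V G u" "y' \<in> rist V G u" using x S(1) TR y by auto
  have yw: "y \<in> rist V G w" "y' \<in> rist V G w" using T(1) y by auto
  note b = rist_bij[OF xR(1)] rist_bij[OF xR(2)] rist_bij[OF xR(3)] rist_bij[OF xR(4)]
  \<comment> \<open>Chosen so that multiplying \<open>x \<circ> y\<close> on the right by
    \<open>k\<close>, \<open>l\<close> and \<open>k \<circ> l\<close> gives the other three corners
    of the square.\<close>
  define k where "k = iv y \<circ> iv x \<circ> x' \<circ> y"
  define l where "l = iv y \<circ> y'"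
  have kR: "k \<in> rist V G u" and lR: "l \<in> rist V G u" using xR by (simp_all add: k_def l_def rist_comp rist_iv)
  have lw: "l \<in> rist V G w" using yw by (simp add: l_def rist_comp rist_iv)
  have kG: "k \<in> G" using rist_G[OF kR] .
  have bk: "bij k" using G_bij[OF kG] .
  have "iv k \<circ> iv l \<circ> k \<circ> l \<in> N"
  proof (rule monochromatic_commutator[OF _ kR lR])
    show "x \<circ> y \<in> rist V G u" using xR by (simp add: rist_comp)
    have "(x \<circ> y) \<circ> k = x' \<circ> y" "(x \<circ> y) \<circ> l = x \<circ> y'" "(x \<circ> y) \<circ> (k \<circ> l) = x' \<circ> y'"
      using b by (simp_all add: k_def l_def bij_group_simps)
    then show "col ((x \<circ> y) \<circ> k) = col (x \<circ> y)" "col ((x \<circ> y) \<circ> l) = col (x \<circ> y)"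
      "col ((x \<circ> y) \<circ> (k \<circ> l)) = col (x \<circ> y)"
      using f[OF y(1)] f[OF y(2)] y by (simp_all add: x_def x'_def)
  qed
  moreover have "(iv k \<circ> iv l \<circ> k \<circ> l) z \<noteq> z"
  proof -
    have lz: "l z \<noteq> z"
    proof
      assume "l z = z"
      then have "y (iv y (y' z)) = y z" by (simp add: l_def)
      then have "y' z = y z" using b by simp
      then show False using T(4) y(1,2,3) by (auto simp: inj_on_def)
    qed
    have lzV: "l z \<in> V" "prefix w (l z)" using rist_prefix_iff[OF lw w(1) z(1)] z G_in_iff[OF rist_G[OF lw]] by auto
    have kw: "k w \<noteq> w"
    proof
      assume "k w = w"
      then have "x (y (k w)) = x (y w)" by simp
      then have "x' w = x w" using b rist_root[OF yw(1) w(1)] by (simp add: k_def)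
      then show False using S(4) x by (auto simp: inj_on_def)
    qed
    \<comment> \<open>\<open>l z\<close> stays below \<open>w\<close> and \<open>k\<close> moves
      \<open>w\<close>, so \<open>k (l z)\<close> is off the support of \<open>l\<close>; the
      commutator therefore sends \<open>z\<close> to \<open>l z\<close>.\<close>
    have "prefix (k w) (k (l z))" using G_prefix_iff[OF kG w(1) lzV(1)] lzV(2) by simp
    then have "\<not> prefix w (k (l z))"
      using kw G_length[OF kG w(1)] prefix_same_length by (metis prefix_same_cases)
    then have "iv l (k (l z)) = k (l z)" using rist_fixes[OF rist_iv[OF lw]] by blast
    then show ?thesis using lz bk by simp
  qed
  ultimately show ?thesis by blast
qed

text \<open>Conjugates of \<open>a\<close> and \<open>b\<close> by a \<open>c \<times> c\<close> grid of elements of \<open>L\<close> have pairwise disjoint supports. A product of conjugates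
  of \<open>a\<close> along some part of each row lies in \<open>L\<close>; picking the first element of each part, so does a product of
  conjugates of \<open>b\<close> along some of the rows. The supports of two such products meet in a single cell, so their commutator
  is a conjugate of \<open>[a, b]\<close>.\<close>

lemma rist_commutators_in_H:
  assumes w: "w \<in> V" "prefix u w" and n: "n \<in> N" "n w \<noteq> w" and z: "z \<in> V" "prefix w z"
    and cz: "card P * (card P * card P) + 1 \<le> card ((\<lambda>g. g z) ` rist V G w)"
    and a: "a \<in> rist V G z" and b: "b \<in> rist V G z"
  shows "a \<circ> b \<circ> iv a \<circ> iv b \<in> H"
proof -
  let ?c = "card P"
  obtain T where T: "T \<subseteq> rist V G w" "finite T" "card T = ?c * (?c * ?c) + 1" "inj_on (\<lambda>g. g z) T"
    using rist_orbit_transversal[OF cz] .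
  have TR: "T \<subseteq> rist V G u" using T(1) rist_mono[OF w(2)] by blast
  \<comment> \<open>A colour class large enough to fill a \<open>?c\<close> by \<open>?c\<close>
    grid.\<close>
  have "\<exists>p\<in>P. ?c * ?c < card {g \<in> T. col g = p}"
  proof (rule ccontr)
    assume "\<not> ?thesis"
    then have le: "card {g \<in> T. col g = p} \<le> ?c * ?c" if "p \<in> P" for p using that by auto
    have "T = (\<Union>p\<in>P. {g \<in> T. col g = p})" using TR col_P by blast
    then have "card T \<le> (\<Sum>p\<in>P. card {g \<in> T. col g = p})"
      using card_UN_le[OF finite_P, of "\<lambda>p. {g \<in> T. col g = p}"] by simp
    also have "\<dots> \<le> ?c * (?c * ?c)" using sum_bounded_above[of P "\<lambda>p. card {g \<in> T. col g = p}" "?c * ?c"] le by simp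
    finally show False using T(3) by simp
  qed
  then obtain p where p: "p \<in> P" "?c * ?c < card {g \<in> T. col g = p}" by blast
  define T' where "T' = {g \<in> T. col g = p}"
  have "card T' \<noteq> 0" using p(2) unfolding T'_def by linarith
  then have "T' \<noteq> {}" by auto
  then obtain g1 where g1: "g1 \<in> T'" by blast
  have g1R: "g1 \<in> rist V G w" "g1 \<in> rist V G u" using g1 T(1) TR by (auto simp: T'_def)
  \<comment> \<open>Translating the class by the inverse of one of its members puts it into
    \<open>L\<close>.\<close>
  define Y where "Y = (\<lambda>g. iv g1 \<circ> g) ` T'"
  have b1: "bij g1" using rist_bij[OF g1R(1)] .
  have injg: "iv g1 s = iv g1 t \<longleftrightarrow> s = t" for s t using b1 by (metis iv_apply(2))
  have Y: "Y \<subseteq> L" "Y \<subseteq> rist V G w" "finite Y"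
    using same_colour_normalizes[OF g1R(2)] TR T(1,2) g1 rist_comp[OF rist_iv[OF g1R(1)]] unfolding Y_def T'_def by auto
  have injY: "inj_on (\<lambda>g. g z) Y"
    using T(4) unfolding Y_def T'_def inj_on_def by (auto simp: injg)
  have "inj_on (\<lambda>g. iv g1 \<circ> g) T'"
    using T(4) unfolding T'_def inj_on_def by (auto simp: injg fun_eq_iff)
  then have cY: "?c * ?c < card Y" using p by (simp add: Y_def T'_def card_image)
  obtain \<gamma> where \<gamma>: "\<gamma> ` ({..<?c} \<times> {..<?c}) \<subseteq> Y" "inj_on \<gamma> ({..<?c} \<times> {..<?c})"
    using card_le_inj[of "{..<?c} \<times> {..<?c}" Y] cY Y(3) by (auto simp: card_cartesian_product)
  have gL: "\<gamma> (r, j) \<in> L" and gw: "\<gamma> (r, j) \<in> rist V G w" if "r < ?c" "j < ?c" for r j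
    using \<gamma>(1) Y that by auto
  have gz: "\<gamma> (r, j) z = \<gamma> (r', j') z \<longleftrightarrow> r = r' \<and> j = j'" if "r < ?c" "j < ?c" "r' < ?c" "j' < ?c" for r j r' j'
  proof
    assume "\<gamma> (r, j) z = \<gamma> (r', j') z"
    moreover have "\<gamma> (r, j) \<in> Y" "\<gamma> (r', j') \<in> Y" using \<gamma>(1) that by auto
    ultimately have "\<gamma> (r, j) = \<gamma> (r', j')" using injY by (auto simp: inj_on_def)
    then show "r = r' \<and> j = j'" using \<gamma>(2) that unfolding inj_on_def by blast
  qed simp
  have gzl: "length (\<gamma> (r, j) z) = length z" if "r < ?c" "j < ?c" for r j
    using G_length[OF rist_G[OF gw[OF that]] z(1)] .
  \<comment> \<open>Distinct cells are distinct vertices of one level, so no word lies below two of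
    them.\<close>
  have sep: "r = r' \<and> j = j'"
    if "r < ?c" "j < ?c" "r' < ?c" "j' < ?c" "prefix (\<gamma> (r, j) z) x" "prefix (\<gamma> (r', j') z) x" for r j r' j' x
  proof -
    have "\<gamma> (r, j) z = \<gamma> (r', j') z"
      using that(5,6) gzl[OF that(1,2)] gzl[OF that(3,4)] prefix_same_length by (metis prefix_same_cases)
    then show ?thesis using gz that by blast
  qed
  define cj where "cj d r j = \<gamma> (r, j) \<circ> d \<circ> iv (\<gamma> (r, j))" for d r j
  have cjz: "cj d r j \<in> rist V G (\<gamma> (r, j) z)" if "d \<in> rist V G z" "r < ?c" "j < ?c" for d r j
    using rist_conj[OF rist_G[OF gw[OF that(2,3)]] that(1) z(1)] by (simp add: cj_def)
  have cjw: "cj d r j \<in> rist V G w" if "d \<in> rist V G z" "r < ?c" "j < ?c" for d r j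
    using that rist_mono[OF z(2)] gw[OF that(2,3)] by (auto simp: cj_def intro!: rist_comp rist_iv)
  have wu: "rist V G w \<subseteq> rist V G u" using rist_mono[OF w(2)] .
  \<comment> \<open>\<open>s r\<close> is the first column of the part kept in row \<open>r\<close>,
    and the remainder is supported in later columns of that row.\<close>
  have "\<forall>r. r < ?c \<longrightarrow> (\<exists>s<?c. \<exists>q\<in>G. cj a r s \<circ> q \<in> L \<and> (\<forall>x. q x \<noteq> x \<longrightarrow> (\<exists>i. s < i \<and> i < ?c \<and> cj a r i x \<noteq> x)))"
    using exists_interval_in_L[of "cj a _"] cjw[OF a] wu by blast
  then obtain s q where sq: "\<And>r. r < ?c \<Longrightarrow> s r < ?c" "\<And>r. r < ?c \<Longrightarrow> q r \<in> G"
      "\<And>r. r < ?c \<Longrightarrow> cj a r (s r) \<circ> q r \<in> L"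
      "\<And>r x. r < ?c \<Longrightarrow> q r x \<noteq> x \<Longrightarrow> \<exists>i. s r < i \<and> i < ?c \<and> cj a r i x \<noteq> x"
    by metis
  \<comment> \<open>The second selection runs over the rows, along the conjugates of
    \<open>b\<close> at the leading cells \<open>(r, s r)\<close>.\<close>
  have "\<exists>r<?c. \<exists>q'\<in>G. cj b r (s r) \<circ> q' \<in> L \<and> (\<forall>x. q' x \<noteq> x \<longrightarrow> (\<exists>i. r < i \<and> i < ?c \<and> cj b i (s i) x \<noteq> x))"
    using exists_interval_in_L[of "\<lambda>r. cj b r (s r)"] cjw[OF b] wu sq(1) by blast
  then obtain r q' where r: "r < ?c" "q' \<in> G" "cj b r (s r) \<circ> q' \<in> L"
      "\<And>x. q' x \<noteq> x \<Longrightarrow> \<exists>i. r < i \<and> i < ?c \<and> cj b i (s i) x \<noteq> x"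
    by blast
  have sr: "s r < ?c" using sq(1) r(1) .
  define Q where "Q = q r"
  define a' where "a' = cj a r (s r)"
  define b' where "b' = cj b r (s r)"
  have QG: "Q \<in> G" using sq(2) r(1) by (simp add: Q_def)
  have Qx: "\<exists>i. s r < i \<and> i < ?c \<and> prefix (\<gamma> (r, i) z) x" if "Q x \<noteq> x" for x
  proof -
    from sq(4)[OF r(1) that[unfolded Q_def]]
    obtain i where i: "s r < i" "i < ?c" "cj a r i x \<noteq> x" by (elim exE conjE)
    then show ?thesis using rist_fixes[OF cjz[OF a r(1) i(2)]] by blast
  qed
  have Q'x: "\<exists>i. r < i \<and> i < ?c \<and> prefix (\<gamma> (i, s i) z) x" if "q' x \<noteq> x" for x
  proof -
    from r(4)[OF that] obtain i where i: "r < i" "i < ?c" "cj b i (s i) x \<noteq> x" by (elim exE conjE)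
    then show ?thesis using rist_fixes[OF cjz[OF b i(2) sq(1)[OF i(2)]]] by blast
  qed
  have ax: "prefix (\<gamma> (r, s r) z) x" if "a' x \<noteq> x" for x
    using that rist_fixes[OF cjz[OF a r(1) sr]] by (auto simp: a'_def)
  have bx: "prefix (\<gamma> (r, s r) z) x" if "b' x \<noteq> x" for x
    using that rist_fixes[OF cjz[OF b r(1) sr]] by (auto simp: b'_def)
  have a'w: "a' \<in> rist V G w" "b' \<in> rist V G w" using cjw a b r(1) sr by (auto simp: a'_def b'_def)
  have gzw: "prefix w (\<gamma> (r, j) z)" if "r < ?c" "j < ?c" for r j
    using rist_prefix_iff[OF gw[OF that] w(1) z(1)] z(2) by simp
  have Qw: "Q \<in> rist V G w" unfolding rist_iff
  proof (intro conjI allI impI)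
    fix x assume x: "Q x \<noteq> x"
    then show "x \<in> V" using G_outside[OF QG] by blast
    show "prefix w x" using Qx[OF x] gzw[OF r(1)] prefix_order.trans by blast
  qed (rule QG)
  have Q'w: "q' \<in> rist V G w" unfolding rist_iff
  proof (intro conjI allI impI)
    fix x assume x: "q' x \<noteq> x"
    then show "x \<in> V" using G_outside[OF r(2)] by blast
    show "prefix w x" using Q'x[OF x] gzw sq(1) prefix_order.trans by blast
  qed (rule r(2))
  note bs = rist_bij[OF Qw] rist_bij[OF Q'w] rist_bij[OF a'w(1)] rist_bij[OF a'w(2)]
  \<comment> \<open>\<open>Q\<close> lives in row \<open>r\<close> beyond column \<open>s r\<close>,
    and \<open>q'\<close> in rows beyond \<open>r\<close>; so both avoid the cell
    \<open>(r, s r)\<close> carrying \<open>a'\<close> and \<open>b'\<close>, and each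
    other.\<close>
  have Qb: "Q \<circ> b' = b' \<circ> Q"
  proof (rule disjoint_support_commute[OF bs(1,4)])
    show "Q x = x \<or> b' x = x" for x
    proof (rule ccontr)
      assume "\<not> ?thesis"
      then obtain i where "s r < i" "i < ?c" "prefix (\<gamma> (r, i) z) x" "prefix (\<gamma> (r, s r) z) x" using Qx bx by blast
      then show False using sep[OF r(1) _ r(1) sr] by blast
    qed
  qed
  have Qa: "q' \<circ> a' = a' \<circ> q'"
  proof (rule disjoint_support_commute[OF bs(2,3)])
    show "q' x = x \<or> a' x = x" for x
    proof (rule ccontr)
      assume "\<not> ?thesis"
      then obtain i where "r < i" "i < ?c" "prefix (\<gamma> (i, s i) z) x" "prefix (\<gamma> (r, s r) z) x" using Q'x ax by blast
      then show False using sep[OF _ sq(1) r(1) sr] by blast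
    qed
  qed
  have QQ: "q' \<circ> Q = Q \<circ> q'"
  proof (rule disjoint_support_commute[OF bs(2,1)])
    show "q' x = x \<or> Q x = x" for x
    proof (rule ccontr)
      assume "\<not> ?thesis"
      then obtain i j where "r < i" "i < ?c" "prefix (\<gamma> (i, s i) z) x" "j < ?c" "prefix (\<gamma> (r, j) z) x" using Q'x Qx by blast
      then show False using sep[OF _ sq(1) r(1)] by blast
    qed
  qed
  define A where "A = a' \<circ> Q"
  define B where "B = b' \<circ> q'"
  have A: "A \<in> L" "A \<in> rist V G w" using sq(3)[OF r(1)] a'w(1) Qw by (auto simp: A_def a'_def Q_def rist_comp)
  have B: "B \<in> L" "B \<in> rist V G w" using r(3) a'w(2) Q'w by (auto simp: B_def b'_def rist_comp)
  have "A \<circ> B = a' \<circ> (Q \<circ> b') \<circ> q'" by (simp add: A_def B_def comp_assoc)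
  also have "\<dots> = (a' \<circ> b') \<circ> (Q \<circ> q')" unfolding Qb by (simp add: comp_assoc)
  finally have AB: "A \<circ> B = (a' \<circ> b') \<circ> (Q \<circ> q')" .
  have "B \<circ> A = b' \<circ> (q' \<circ> a') \<circ> Q" by (simp add: A_def B_def comp_assoc)
  also have "\<dots> = (b' \<circ> a') \<circ> (q' \<circ> Q)" unfolding Qa by (simp add: comp_assoc)
  finally have BA: "B \<circ> A = (b' \<circ> a') \<circ> (Q \<circ> q')" unfolding QQ .
  \<comment> \<open>Both products end in the factor \<open>Q \<circ> q'\<close>, which cancels in
    the commutator.\<close>
  have "A \<circ> B \<circ> iv A \<circ> iv B = (A \<circ> B) \<circ> iv (B \<circ> A)"
    using rist_bij[OF A(2)] rist_bij[OF B(2)] by (simp add: bij_group_simps)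
  also have "\<dots> = a' \<circ> b' \<circ> iv a' \<circ> iv b'" unfolding AB BA using bs by (simp add: bij_group_simps)
  finally have ab': "a' \<circ> b' \<circ> iv a' \<circ> iv b' \<in> N"
    using normalizer_commutator[OF n(1) w(1) n(2) A B] by simp
  define g where "g = \<gamma> (r, s r)"
  have gL': "g \<in> L" using gL[OF r(1) sr] by (simp add: g_def)
  note bg = rist_bij[OF L_rist[OF gL']] rist_bij[OF a] rist_bij[OF b]
  have "iv g \<circ> (a' \<circ> b' \<circ> iv a' \<circ> iv b') \<circ> g = a \<circ> b \<circ> iv a \<circ> iv b"
    using bg by (simp add: a'_def b'_def cj_def flip: g_def add: bij_group_simps)
  then have "a \<circ> b \<circ> iv a \<circ> iv b \<in> N" using L_conj_iv[OF gL' ab'] by simp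
  then show ?thesis by (simp add: N_def)
qed

end

section \<open>A level common to all subgroups confined near a vertex\<close>

context branch_group
begin

text \<open>The order of quantifiers matters: \<open>l\<close> is built from \<open>u\<close> and
  \<open>card P\<close> before \<open>H\<close> is given. Three successive levels make orbits large
  enough for \<open>N_moves\<close> and then for \<open>rist_commutators_in_H\<close>.\<close>

theorem confined_contains_commutators:
  assumes u: "u \<in> V" and P: "finite P" "P \<subseteq> G" "\<And>p. p \<in> P \<Longrightarrow> p u \<noteq> u"
  shows "\<exists>l. \<forall>H. subgroup H (aut_group V) \<and> H \<subseteq> G \<and> (\<forall>g\<in>rist V G u. \<exists>p\<in>P. iv g \<circ> p \<circ> g \<in> H) \<longrightarrow>
    (\<forall>z\<in>V. prefix u z \<and> l \<le> length z \<longrightarrow>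
      (\<forall>a\<in>rist V G z. \<forall>b\<in>rist V G z. a \<circ> b \<circ> iv a \<circ> iv b \<in> H))"
proof -
  let ?c = "card P"
  have "\<exists>f. \<forall>w\<in>V. length w \<le> f w \<and> (\<forall>z\<in>V. prefix w z \<and> f w \<le> length z \<longrightarrow> n \<le> card ((\<lambda>g. g z) ` rist V G w))" for n
    using rist_orbits_large by (intro bchoice) blast
  then obtain f where f: "\<And>n w. w \<in> V \<Longrightarrow> length w \<le> f n w"
    "\<And>n w z. w \<in> V \<Longrightarrow> z \<in> V \<Longrightarrow> prefix w z \<Longrightarrow> f n w \<le> length z \<Longrightarrow> n \<le> card ((\<lambda>g. g z) ` rist V G w)"
    by metis
  define lev where "lev n = {w \<in> V. length w = n}" for n
  have fin: "finite (lev n)" for n using finite_level[OF tree] by (simp add: lev_def)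
  define l1 where "l1 = f (?c + 1) u"
  \<comment> \<open>A sum over a finite level stands in for a maximum, so one level serves all
    vertices of the previous one.\<close>
  define l2 where "l2 = l1 + (\<Sum>w\<in>lev l1. f ((?c + 1) * (?c + 1) * ?c + 1) w)"
  define l3 where "l3 = l2 + (\<Sum>w\<in>lev l2. f (?c * (?c * ?c) + 1) w)"
  show ?thesis
  proof (intro exI[of _ l3] allI impI ballI)
    fix H z a b
    assume H: "subgroup H (aut_group V) \<and> H \<subseteq> G \<and> (\<forall>g\<in>rist V G u. \<exists>p\<in>P. iv g \<circ> p \<circ> g \<in> H)"
      and zV: "z \<in> V" and zl: "prefix u z \<and> l3 \<le> length z" and ab: "a \<in> rist V G z" "b \<in> rist V G z"
    note z = zV conjunct1[OF zl] conjunct2[OF zl]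
    have H_comp: "g \<circ> h \<in> H" if "g \<in> H" "h \<in> H" for g h
      using H that subgroup.m_closed[of H "aut_group V" g h] by (simp add: aut_group_def)
    have H_iv: "iv g \<in> H" if "g \<in> H" for g
    proof -
      have "g \<in> aut V" using H that G_aut by blast
      then show ?thesis
        using H that subgroup.m_inv_closed[of H "aut_group V" g] inv_aut_group[OF tree, of g] by simp
    qed
    have "\<forall>g\<in>rist V G u. \<exists>p. p \<in> P \<and> iv g \<circ> p \<circ> g \<in> H" using H by blast
    then obtain col where col: "\<And>g. g \<in> rist V G u \<Longrightarrow> col g \<in> P" "\<And>g. g \<in> rist V G u \<Longrightarrow> iv g \<circ> col g \<circ> g \<in> H"
      by (metis bchoice)
    interpret confined_subgroup V G H u P col
      by unfold_locales (use u H H_comp H_iv P col in auto)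
    have ll: "length u \<le> l1" "l1 \<le> l2" "l2 \<le> l3" using f(1)[OF u] by (auto simp: l1_def l2_def l3_def)
    \<comment> \<open>\<open>N_moves\<close> is applied along \<open>u\<close>, \<open>v\<close>,
      \<open>w\<close> to move \<open>w\<close>; the commutators are then found below
      \<open>w\<close> at \<open>z\<close>.\<close>
    define v where "v = take l1 z"
    define w where "w = take l2 z"
    have v: "v \<in> V" "v \<in> lev l1" "prefix u v" "prefix v w" and w: "w \<in> V" "w \<in> lev l2" "prefix u w" "prefix w z"
      using z ll tree_take[OF tree z(1)] by (auto simp: v_def w_def lev_def prefix_iff_take min_def)
    have "f ((?c + 1) * (?c + 1) * ?c + 1) v \<le> l2"
      unfolding l2_def using member_le_sum[OF v(2), of "f ((?c + 1) * (?c + 1) * ?c + 1)"] fin by simp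
    moreover have "f (?c * (?c * ?c) + 1) w \<le> l3"
      unfolding l3_def using member_le_sum[OF w(2), of "f (?c * (?c * ?c) + 1)"] fin by simp
    moreover have "length v = l1" "length w = l2" using v w by (auto simp: lev_def)
    ultimately have c1: "?c + 1 \<le> card ((\<lambda>g. g v) ` rist V G u)"
      and c2: "(?c + 1) * (?c + 1) * ?c + 1 \<le> card ((\<lambda>g. g w) ` rist V G v)"
      and c3: "?c * (?c * ?c) + 1 \<le> card ((\<lambda>g. g z) ` rist V G w)"
      using f(2)[OF u v(1,3)] f(2)[OF v(1) w(1) v(4)] f(2)[OF w(1) z(1) w(4)] z(3)
      by (simp_all add: l1_def)
    obtain n where n: "n \<in> N" "n w \<noteq> w" using N_moves[OF v(1,3) w(1) v(4) c1 c2] by blast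
    show "a \<circ> b \<circ> iv a \<circ> iv b \<in> H"
      using rist_commutators_in_H[OF w(1,3) n z(1) w(4) c3 ab] .
  qed
qed

end

section \<open>The boundary\<close>

abbreviation initial :: "(nat \<Rightarrow> nat) \<Rightarrow> nat \<Rightarrow> nat list" where
  "initial \<xi> n \<equiv> map \<xi> [0..<n]"

lemma take_initial: "n \<le> m \<Longrightarrow> take n (initial \<xi> m) = initial \<xi> n"
  by (simp add: take_map)

lemma initial_eqI: "(\<And>n. initial \<xi> n = initial \<eta> n) \<Longrightarrow> \<xi> = \<eta>"
proof
  fix n assume eq: "\<And>n. initial \<xi> n = initial \<eta> n"
  show "\<xi> n = \<eta> n" using eq[of "Suc n"] by simp
qed

lemma boundary_sub_iff: "\<xi> \<in> boundary_sub V v \<longleftrightarrow> \<xi> \<in> boundary V \<and> initial \<xi> (length v) = v"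
  by (simp add: boundary_sub_def)

lemma boundary_sub_initial: "\<xi> \<in> boundary V \<Longrightarrow> \<xi> \<in> boundary_sub V (initial \<xi> n)"
  by (simp add: boundary_sub_def)

lemma boundary_sub_mono: "prefix v w \<Longrightarrow> boundary_sub V w \<subseteq> boundary_sub V v"
  using take_initial unfolding prefix_iff_take boundary_sub_iff subset_iff by metis

lemma initial_in: "\<xi> \<in> boundary V \<Longrightarrow> initial \<xi> n \<in> V"
  by (simp add: boundary_def)

context
  fixes V :: "nat list set"
  assumes tree: "rooted_tree V"
begin

text \<open>Coordinate \<open>n\<close> of \<open>bact g \<xi>\<close> is read from the image of the
  prefix of length \<open>Suc n\<close>; automorphisms commute with truncation, so longer prefixes
  agree.\<close>

lemma initial_bact:
  assumes g: "g \<in> aut V" and \<xi>: "\<xi> \<in> boundary V"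
  shows "initial (bact g \<xi>) n = g (initial \<xi> n)"
proof (rule nth_equalityI)
  show len: "length (initial (bact g \<xi>) n) = length (g (initial \<xi> n))"
    using aut_length[OF tree g initial_in[OF \<xi>]] by simp
  fix i assume "i < length (initial (bact g \<xi>) n)"
  then have i: "i < n" by simp
  have "initial (bact g \<xi>) n ! i = g (initial \<xi> (Suc i)) ! i" using i by (simp add: bact_def del: upt_Suc)
  also have "initial \<xi> (Suc i) = take (Suc i) (initial \<xi> n)" using i take_initial[of "Suc i" n \<xi>] by simp
  also have "g (take (Suc i) (initial \<xi> n)) = take (Suc i) (g (initial \<xi> n))"
    by (rule aut_take[OF tree g initial_in[OF \<xi>]])
  finally show "initial (bact g \<xi>) n ! i = g (initial \<xi> n) ! i" by simp
qed

lemma bact_boundary: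
  assumes "g \<in> aut V" "\<xi> \<in> boundary V" shows "bact g \<xi> \<in> boundary V"
  unfolding boundary_def
  using initial_bact[OF assms] aut_in_iff[OF tree assms(1)] initial_in[OF assms(2)] by simp

lemma bact_boundary_sub_iff:
  assumes g: "g \<in> aut V" and \<xi>: "\<xi> \<in> boundary V" and v: "v \<in> V"
  shows "bact g \<xi> \<in> boundary_sub V (g v) \<longleftrightarrow> \<xi> \<in> boundary_sub V v"
  using initial_bact[OF g \<xi>] bact_boundary[OF g \<xi>] aut_length[OF tree g v] \<xi> aut_bij[OF tree g]
  by (simp add: boundary_sub_iff bij_def inj_eq)

lemma Fix_iff:
  assumes H: "H \<subseteq> aut V" and \<xi>: "\<xi> \<in> boundary V"
  shows "\<xi> \<in> Fix V H \<longleftrightarrow> (\<forall>h\<in>H. \<forall>n. h (initial \<xi> n) = initial \<xi> n)"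
proof -
  have "bact h \<xi> = \<xi> \<longleftrightarrow> (\<forall>n. h (initial \<xi> n) = initial \<xi> n)" if "h \<in> H" for h
    using initial_bact[of h \<xi>] H \<xi> that initial_eqI[of "bact h \<xi>" \<xi>] by (metis subsetD)
  then show ?thesis using \<xi> by (simp add: Fix_def)
qed

text \<open>Koenig's lemma: by finite branching, a vertex with infinitely many extensions in
  \<open>A\<close> has a child of the same kind.\<close>

lemma koenig:
  assumes sub: "A \<subseteq> V" and prefix_closed: "\<And>v w. w \<in> A \<Longrightarrow> prefix v w \<Longrightarrow> v \<in> A"
    and levels: "\<And>n. \<exists>w\<in>A. length w = n"
  obtains \<xi> where "\<xi> \<in> boundary V" "\<And>n. initial \<xi> n \<in> A"
proof -
  define big where "big w \<longleftrightarrow> infinite {x \<in> A. prefix w x}" for w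
  have big_in: "w \<in> A" if "big w" for w
  proof -
    have "{x \<in> A. prefix w x} \<noteq> {}" using that unfolding big_def by (metis finite.emptyI)
    then show ?thesis using prefix_closed by blast
  qed
  have "infinite A"
  proof
    assume "finite A"
    then have "finite (length ` A)" by simp
    moreover have "length ` A = UNIV" using levels by (metis UNIV_eq_I image_iff)
    ultimately show False by simp
  qed
  then have big0: "big []" by (simp add: big_def)
  have step: "\<exists>i. big (w @ [i])" if "big w" for w
  proof (rule ccontr)
    assume "\<not> ?thesis"
    then have fin: "finite {x \<in> A. prefix (w @ [i]) x}" for i by (simp add: big_def)
    have "{x \<in> A. prefix w x} \<subseteq> {w} \<union> (\<Union>i\<in>{i. w @ [i] \<in> V}. {x \<in> A. prefix (w @ [i]) x})"
    proof
      fix x assume "x \<in> {x \<in> A. prefix w x}"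
      then have x: "x \<in> A" "prefix w x" by auto
      then obtain zs where zs: "x = w @ zs" by (auto simp: prefix_def)
      show "x \<in> {w} \<union> (\<Union>i\<in>{i. w @ [i] \<in> V}. {x \<in> A. prefix (w @ [i]) x})"
      proof (cases zs)
        case (Cons i ys)
        then have "prefix (w @ [i]) x" using zs by (auto simp: prefix_def)
        then show ?thesis using x(1) prefix_closed sub by blast
      qed (use zs in simp)
    qed
    moreover have "finite {i. w @ [i] \<in> V}" using tree big_in[OF that] sub by (auto simp: rooted_tree_def)
    ultimately have "finite {x \<in> A. prefix w x}" using fin by (simp add: finite_subset)
    then show False using that by (simp add: big_def)
  qed
  define nxt where "nxt w = w @ [SOME i. big (w @ [i])]" for w
  have nxt: "big (nxt w)" if "big w" for w
    using someI_ex[OF step[OF that]] by (simp add: nxt_def)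
  define W where "W n = (nxt ^^ n) []" for n
  have W: "big (W n) \<and> length (W n) = n" for n
    by (induction n) (simp_all add: W_def big0 nxt, simp add: nxt_def)
  define \<xi> where "\<xi> n = W (Suc n) ! n" for n
  have in_W: "initial \<xi> n = W n" for n
  proof (induction n)
    case 0
    then show ?case by (simp add: W_def)
  next
    case (Suc n)
    have "W (Suc n) = W n @ [\<xi> n]"
      using W[of n] by (simp add: \<xi>_def) (simp add: W_def nxt_def nth_append)
    then show ?case using Suc by simp
  qed
  show ?thesis
  proof (rule that)
    show "initial \<xi> n \<in> A" for n using in_W W big_in by simp
    then show "\<xi> \<in> boundary V" using sub by (auto simp: boundary_def)
  qed
qed

text \<open>Reduces the absence of fixed points to finitely many vertices, hence to an open
  condition. If every level had a vertex below \<open>v\<close> fixed by all of \<open>H\<close>,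
  Koenig's lemma would give a fixed ray.\<close>

lemma no_fixed_point_iff:
  assumes H: "H \<subseteq> aut V" and v: "v \<in> V"
  shows "Fix V H \<inter> boundary_sub V v = {} \<longleftrightarrow>
    (\<exists>m\<ge>length v. \<forall>u\<in>V. length u = m \<and> prefix v u \<longrightarrow> (\<exists>h\<in>H. h u \<noteq> u))" (is "?l \<longleftrightarrow> ?r")
proof
  assume ?r
  then obtain m where m: "m \<ge> length v" "\<And>u. u \<in> V \<Longrightarrow> length u = m \<Longrightarrow> prefix v u \<Longrightarrow> \<exists>h\<in>H. h u \<noteq> u" by blast
  have False if \<xi>: "\<xi> \<in> Fix V H" "\<xi> \<in> boundary_sub V v" for \<xi>
  proof -
    have b: "\<xi> \<in> boundary V" using \<xi>(2) by (simp add: boundary_sub_iff)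
    have "prefix v (initial \<xi> m)"
      using \<xi>(2) m(1) take_initial[of "length v" m \<xi>] by (simp add: prefix_iff_take boundary_sub_iff)
    then show False using m(2)[OF initial_in[OF b]] Fix_iff[OF H b] \<xi>(1) by simp
  qed
  then show ?l by blast
next
  assume l: ?l
  show ?r
  proof (rule ccontr)
    assume nr: "\<not> ?r"
    \<comment> \<open>Prefixes of commonly fixed vertices are fixed too; including those above
      \<open>v\<close> makes \<open>A\<close> prefix-closed down to the root.\<close>
    define A where "A = {w. \<exists>u\<in>V. prefix v u \<and> (\<forall>h\<in>H. h u = u) \<and> prefix w u}"
    have take_fixed: "h w = w" if "h \<in> H" "u \<in> V" "h u = u" "prefix w u" for h u w
      using aut_take[OF tree, of h u "length w"] that H by (auto simp: prefix_iff_take)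
    obtain \<xi> where \<xi>: "\<xi> \<in> boundary V" "\<And>n. initial \<xi> n \<in> A"
    proof (rule koenig[of A])
      show "A \<subseteq> V" using tree_prefix[OF tree] by (auto simp: A_def)
      show "x \<in> A" if "w \<in> A" "prefix x w" for x w
        using that prefix_order.trans unfolding A_def by blast
      show "\<exists>w\<in>A. length w = n" for n
      proof -
        obtain u where u: "u \<in> V" "length u = max n (length v)" "prefix v u" "\<And>h. h \<in> H \<Longrightarrow> h u = u"
          using nr by (metis max.cobounded2)
        then have "take n u \<in> A" unfolding A_def using take_is_prefix by blast
        then show ?thesis using u(2) by (intro bexI[of _ "take n u"]) auto
      qed
    qed (rule that)
    have "\<xi> \<in> Fix V H"
    proof -
      have "h (initial \<xi> n) = initial \<xi> n" if h: "h \<in> H" for h n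
      proof -
        from \<xi>(2)[of n] obtain u where "u \<in> V" "h u = u" "prefix (initial \<xi> n) u"
          using h unfolding A_def by auto
        then show ?thesis by (rule take_fixed[OF h])
      qed
      then show ?thesis using Fix_iff[OF H \<xi>(1)] by blast
    qed
    moreover have "\<xi> \<in> boundary_sub V v"
    proof -
      obtain u where "prefix v u" "prefix (initial \<xi> (length v)) u" using \<xi>(2)[of "length v"] by (auto simp: A_def)
      then have "initial \<xi> (length v) = v" by (simp add: prefix_iff_take)
      then show ?thesis using \<xi>(1) by (simp add: boundary_sub_iff)
    qed
    ultimately show False using l by blast
  qed
qed

end

section \<open>Topology of the boundary\<close>

lemma topspace_boundary_top [simp]: "topspace (boundary_top V) = boundary V"
  by (simp add: boundary_top_def)

lemma openin_boundary_sub: "openin (boundary_top V) (boundary_sub V v)"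
proof -
  let ?B = "Pi\<^sub>E UNIV (\<lambda>i. if i < length v then {v ! i} else UNIV)"
  have "openin (product_topology (\<lambda>_. discrete_topology UNIV) UNIV) ?B"
  proof (rule product_topology_basis)
    have "{i. (if i < length v then {v ! i} else UNIV) \<noteq> topspace (discrete_topology UNIV)} \<subseteq> {..<length v}"
      by (auto split: if_splits)
    then show "finite {i. (if i < length v then {v ! i} else UNIV) \<noteq> topspace (discrete_topology UNIV)}"
      by (rule finite_subset) simp
  qed simp
  moreover have "boundary_sub V v = ?B \<inter> boundary V"
  proof (intro subset_antisym subsetI)
    have eq: "initial \<xi> (length v) = v \<longleftrightarrow> (\<forall>i<length v. \<xi> i = v ! i)" for \<xi>
      by (subst list_eq_iff_nth_eq) simp
    show "\<xi> \<in> ?B \<inter> boundary V" if "\<xi> \<in> boundary_sub V v" for \<xi>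
      using that unfolding boundary_sub_iff eq PiE_UNIV_domain by auto
    show "\<xi> \<in> boundary_sub V v" if "\<xi> \<in> ?B \<inter> boundary V" for \<xi>
    proof -
      have "\<xi> i = v ! i" if "i < length v" for i
      proof -
        have "\<xi> i \<in> (if i < length v then {v ! i} else UNIV)"
          by (rule PiE_mem[of \<xi> UNIV]) (rule IntD1[OF \<open>\<xi> \<in> ?B \<inter> boundary V\<close>], rule UNIV_I)
        then show ?thesis using that by simp
      qed
      then show ?thesis using that unfolding boundary_sub_iff eq by simp
    qed
  qed
  ultimately show ?thesis unfolding boundary_top_def openin_subtopology by blast
qed

text \<open>A basic open box restricts finitely many coordinates, so a long enough cylinder lies
  inside it.\<close>

lemma boundary_nbhd:
  assumes "openin (boundary_top V) U" "\<xi> \<in> U"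
  obtains n where "boundary_sub V (initial \<xi> n) \<subseteq> U"
proof -
  obtain U' where U': "openin (product_topology (\<lambda>_. discrete_topology UNIV) UNIV) U'" "U = U' \<inter> boundary V"
    using assms(1) by (auto simp: boundary_top_def openin_subtopology)
  then obtain B where B: "finite {i. B i \<noteq> (UNIV :: nat set)}" "\<xi> \<in> Pi\<^sub>E UNIV B" "Pi\<^sub>E UNIV B \<subseteq> U'"
    using assms(2) by (auto simp: openin_product_topology_alt)
  obtain n where n: "\<And>i. B i \<noteq> UNIV \<Longrightarrow> i < n" using finite_nat_bounded[OF B(1)] by auto
  have "boundary_sub V (initial \<xi> n) \<subseteq> U"
  proof
    fix \<eta> assume \<eta>: "\<eta> \<in> boundary_sub V (initial \<xi> n)"
    have "\<eta> i \<in> B i" for i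
    proof (cases "B i = UNIV")
      case False
      then have "\<eta> i = \<xi> i" using n \<eta> by (simp add: boundary_sub_iff)
      then show ?thesis using B(2) by auto
    qed simp
    then show "\<eta> \<in> U" using B(3) \<eta> U'(2) by (auto simp: boundary_sub_iff)
  qed
  then show ?thesis using that by blast
qed

lemma closedin_boundary_iff:
  "closedin (boundary_top V) F \<longleftrightarrow> F \<subseteq> boundary V \<and>
    (\<forall>\<xi>\<in>boundary V - F. \<exists>n. F \<inter> boundary_sub V (initial \<xi> n) = {})" (is "?l \<longleftrightarrow> ?r")
proof
  assume l: ?l
  then have F: "F \<subseteq> boundary V" "openin (boundary_top V) (boundary V - F)" by (auto simp: closedin_def)
  have "\<exists>n. F \<inter> boundary_sub V (initial \<xi> n) = {}" if \<xi>: "\<xi> \<in> boundary V - F" for \<xi>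
  proof -
    obtain n where "boundary_sub V (initial \<xi> n) \<subseteq> boundary V - F" using boundary_nbhd[OF F(2) \<xi>] .
    then show ?thesis by blast
  qed
  then show ?r using F(1) by blast
next
  assume r: ?r
  then obtain n where n: "\<And>\<xi>. \<xi> \<in> boundary V - F \<Longrightarrow> F \<inter> boundary_sub V (initial \<xi> (n \<xi>)) = {}" by metis
  have "boundary V - F = (\<Union>\<xi>\<in>boundary V - F. boundary_sub V (initial \<xi> (n \<xi>)))"
  proof (intro subset_antisym subsetI)
    fix \<xi> assume "\<xi> \<in> boundary V - F"
    then show "\<xi> \<in> (\<Union>\<xi>\<in>boundary V - F. boundary_sub V (initial \<xi> (n \<xi>)))"
      by (intro UN_I[of \<xi>]) (auto simp: boundary_sub_initial)
  next
    fix \<eta> assume "\<eta> \<in> (\<Union>\<xi>\<in>boundary V - F. boundary_sub V (initial \<xi> (n \<xi>)))"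
    then obtain \<xi> where \<xi>: "\<xi> \<in> boundary V - F" "\<eta> \<in> boundary_sub V (initial \<xi> (n \<xi>))" by blast
    then have "\<eta> \<notin> F" using n[OF \<xi>(1)] by blast
    then show "\<eta> \<in> boundary V - F" using \<xi>(2) by (simp add: boundary_sub_iff)
  qed
  moreover have "openin (boundary_top V) \<dots>" using openin_boundary_sub by blast
  ultimately show ?l using r by (simp add: closedin_def)
qed

lemma closedin_boundary_sub: "closedin (boundary_top V) (boundary_sub V v)"
  unfolding closedin_boundary_iff
proof (intro conjI ballI exI)
  fix \<xi> assume \<xi>: "\<xi> \<in> boundary V - boundary_sub V v"
  have False if "\<eta> \<in> boundary_sub V v" "\<eta> \<in> boundary_sub V (initial \<xi> (length v))" for \<eta>
  proof -
    have "initial \<eta> (length v) = v" "initial \<eta> (length v) = initial \<xi> (length v)"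
      using that unfolding boundary_sub_iff by simp_all
    then show False using \<xi> by (simp add: boundary_sub_iff)
  qed
  then show "boundary_sub V v \<inter> boundary_sub V (initial \<xi> (length v)) = {}" by blast
qed (auto simp: boundary_sub_iff)

lemma closedin_Fix:
  assumes "rooted_tree V" and H: "H \<subseteq> aut V"
  shows "closedin (boundary_top V) (Fix V H)"
  unfolding closedin_boundary_iff
proof (intro conjI ballI)
  show "Fix V H \<subseteq> boundary V" by (auto simp: Fix_def)
  fix \<xi> assume \<xi>: "\<xi> \<in> boundary V - Fix V H"
  then obtain h n where h: "h \<in> H" "h (initial \<xi> n) \<noteq> initial \<xi> n"
    using Fix_iff[OF assms, of \<xi>] by blast
  have False if "\<eta> \<in> Fix V H" "\<eta> \<in> boundary_sub V (initial \<xi> n)" for \<eta>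
  proof -
    have b: "\<eta> \<in> boundary V" "initial \<eta> n = initial \<xi> n" using that(2) by (auto simp: boundary_sub_iff)
    then show False using Fix_iff[OF assms b(1)] that(1) h by metis
  qed
  then show "\<exists>n. Fix V H \<inter> boundary_sub V (initial \<xi> n) = {}" by blast
qed

text \<open>Otherwise Koenig's lemma yields a ray all of whose cylinders meet \<open>F\<close> and
  leave \<open>U\<close>. It lies in \<open>F\<close> as \<open>F\<close> is closed, hence in
  \<open>U\<close>, and then some cylinder around it is inside \<open>U\<close>.\<close>

lemma closed_subset_open_level:
  assumes tree: "rooted_tree V" and F: "closedin (boundary_top V) F" and U: "openin (boundary_top V) U" "F \<subseteq> U"
  shows "\<exists>m. \<forall>w\<in>V. length w = m \<longrightarrow> F \<inter> boundary_sub V w = {} \<or> boundary_sub V w \<subseteq> U"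
proof (rule ccontr)
  assume contra: "\<not> ?thesis"
  define A where "A = {w \<in> V. F \<inter> boundary_sub V w \<noteq> {} \<and> \<not> boundary_sub V w \<subseteq> U}"
  obtain \<xi> where \<xi>: "\<xi> \<in> boundary V" "\<And>n. initial \<xi> n \<in> A"
  proof (rule koenig[OF tree, of A])
    show "A \<subseteq> V" by (auto simp: A_def)
    show "v \<in> A" if "w \<in> A" "prefix v w" for v w
      using that tree_prefix[OF tree] boundary_sub_mono[OF that(2), of V] unfolding A_def by blast
    show "\<exists>w\<in>A. length w = n" for n using contra unfolding A_def by blast
  qed (rule that)
  have "\<xi> \<in> F"
    using \<xi> F unfolding closedin_boundary_iff A_def by blast
  then obtain n where "boundary_sub V (initial \<xi> n) \<subseteq> U" using boundary_nbhd[OF U(1)] U(2) by blast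
  then show False using \<xi>(2)[of n] by (simp add: A_def)
qed

section \<open>Minimal actions and lower semi-continuous maps\<close>

locale lsc_map = branch_group V G
  for V :: "nat list set" and G :: "(nat list \<Rightarrow> nat list) set" +
  fixes Y :: "'x topology" and act :: "(nat list \<Rightarrow> nat list) \<Rightarrow> 'x \<Rightarrow> 'x"
    and \<Phi> :: "'x \<Rightarrow> (nat list \<Rightarrow> nat list) set"
  assumes compact: "compact_space Y"
    and act_closed: "g \<in> G \<Longrightarrow> y \<in> topspace Y \<Longrightarrow> act g y \<in> topspace Y"
    and act_iv: "g \<in> G \<Longrightarrow> y \<in> topspace Y \<Longrightarrow> act (iv g) (act g y) = y"
    and minimal: "closedin Y C \<Longrightarrow> (\<And>g. g \<in> G \<Longrightarrow> act g ` C \<subseteq> C) \<Longrightarrow> C = {} \<or> C = topspace Y"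
    and Phi_G: "y \<in> topspace Y \<Longrightarrow> \<Phi> y \<subseteq> G"
    and Phi_subgroup: "y \<in> topspace Y \<Longrightarrow> subgroup (\<Phi> y) (aut_group V)"
    and Phi_equivariant: "g \<in> G \<Longrightarrow> y \<in> topspace Y \<Longrightarrow> \<Phi> (act g y) = (\<lambda>h. g \<circ> h \<circ> iv g) ` \<Phi> y"
    and Phi_lsc: "g \<in> G \<Longrightarrow> openin Y {y \<in> topspace Y. g \<in> \<Phi> y}"
begin

text \<open>The number of vertices \<open>w\<close> of level \<open>n\<close> with \<open>y \<in> U w\<close> is an invariant lower
  semi-continuous function of \<open>y\<close>, so it is constant by minimality.\<close>

lemma equivariant_open_imp_closed:
  assumes op: "\<And>w. w \<in> V \<Longrightarrow> length w = n \<Longrightarrow> openin Y (U w)"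
    and equiv: "\<And>g w y. g \<in> G \<Longrightarrow> w \<in> V \<Longrightarrow> length w = n \<Longrightarrow> y \<in> U w \<Longrightarrow> act g y \<in> U (g w)"
    and w: "w \<in> V" "length w = n"
  shows "closedin Y (U w)"
proof -
  define S where "S y = {w \<in> V. length w = n \<and> y \<in> U w}" for y
  have finS: "finite (S y)" for y
    by (rule finite_subset[OF _ finite_level[OF tree, of n]]) (auto simp: S_def)
  \<comment> \<open>A neighbourhood of \<open>y\<close> on which \<open>S\<close> can only gain
    vertices.\<close>
  define W where "W y = (\<Inter>w\<in>S y. U w) \<inter> topspace Y" for y
  have W: "openin Y (W y)" for y
    unfolding W_def by (rule openin_INT[OF finS]) (use op in \<open>auto simp: S_def\<close>)
  have yW: "y \<in> W y" if "y \<in> topspace Y" for y using that by (auto simp: W_def S_def)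
  have SW: "S y \<subseteq> S z" if "z \<in> W y" for y z using that by (auto simp: W_def S_def)
  have le: "card (S y) \<le> card (S (act g y))" if g: "g \<in> G" for g y
  proof (rule card_inj_on_le[OF _ _ finS])
    show "inj_on g (S y)" using G_bij[OF g] by (meson bij_is_inj inj_on_subset subset_UNIV)
    show "g ` S y \<subseteq> S (act g y)"
      using equiv[OF g] G_in_iff[OF g] G_length[OF g] by (auto simp: S_def)
  qed
  have openU: "openin Y (topspace Y - U w)"
  proof (cases "topspace Y = {}")
    case False
    then obtain y0 where y0: "y0 \<in> topspace Y" "\<And>y. y \<in> topspace Y \<Longrightarrow> card (S y0) \<le> card (S y)"
      using ex_has_least_nat[of "\<lambda>y. y \<in> topspace Y" _ "\<lambda>y. card (S y)"] by blast
    \<comment> \<open>The set where the minimal count is attained; lower semi-continuity makes it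
      closed.\<close>
    define C where "C = {y \<in> topspace Y. card (S y) \<le> card (S y0)}"
    have "openin Y (topspace Y - C)"
    proof (subst openin_subopen, intro ballI)
      fix y assume y: "y \<in> topspace Y - C"
      have "W y \<subseteq> topspace Y - C"
      proof
        fix z assume z: "z \<in> W y"
        then have "card (S y) \<le> card (S z)" using card_mono[OF finS SW] by blast
        then show "z \<in> topspace Y - C" using y z by (auto simp: C_def W_def)
      qed
      then show "\<exists>T. openin Y T \<and> y \<in> T \<and> T \<subseteq> topspace Y - C" using W[of y] yW[of y] y by blast
    qed
    then have "closedin Y C" by (auto simp: closedin_def C_def)
    moreover have "act g ` C \<subseteq> C" if g: "g \<in> G" for g
    proof
      fix z assume "z \<in> act g ` C"
      then obtain y where y: "y \<in> topspace Y" "card (S y) \<le> card (S y0)" "z = act g y" by (auto simp: C_def)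
      then have "card (S z) \<le> card (S y)" using le[OF G_iv[OF g], of z] act_iv[OF g y(1)] by simp
      then show "z \<in> C" using y act_closed[OF g y(1)] by (simp add: C_def)
    qed
    ultimately have "C = topspace Y" using minimal[of C] y0(1) by (auto simp: C_def)
    then have const: "card (S y) = card (S y0)" if "y \<in> topspace Y" for y
    proof -
      have "y \<in> C" using that \<open>C = topspace Y\<close> by simp
      then show ?thesis using y0(2)[OF that] by (simp add: C_def)
    qed
    show ?thesis
    proof (subst openin_subopen, intro ballI)
      fix y assume y: "y \<in> topspace Y - U w"
      \<comment> \<open>With constant cardinality the inclusion of \<open>S y\<close> in
        \<open>S z\<close> is an equality, so no vertex is gained near \<open>y\<close>.\<close>
      have "W y \<subseteq> topspace Y - U w"
      proof
        fix z assume z: "z \<in> W y"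
        then have zt: "z \<in> topspace Y" by (simp add: W_def)
        then have "S y = S z" using card_subset_eq[OF finS SW[OF z]] const y by simp
        then have "w \<notin> S z" using y by (auto simp: S_def)
        then show "z \<in> topspace Y - U w" using w zt by (simp add: S_def)
      qed
      then show "\<exists>T. openin Y T \<and> y \<in> T \<and> T \<subseteq> topspace Y - U w" using W[of y] yW[of y] y by blast
    qed
  qed simp
  then show ?thesis using openin_subset[OF op[OF w]] by (simp add: closedin_def)
qed

section \<open>Clopen sets of points without fixed ends below a vertex\<close>

definition moving :: "nat list \<Rightarrow> 'x set" where
  "moving u = {y \<in> topspace Y. \<exists>h\<in>\<Phi> y. h u \<noteq> u}"

definition fixfree :: "nat list \<Rightarrow> 'x set" where
  "fixfree v = {y \<in> topspace Y. Fix V (\<Phi> y) \<inter> boundary_sub V v = {}}"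

lemma Phi_aut: "y \<in> topspace Y \<Longrightarrow> \<Phi> y \<subseteq> aut V"
  using Phi_G G_aut by blast

lemma moving_eq: "moving u = (\<Union>h\<in>{h \<in> G. h u \<noteq> u}. {y \<in> topspace Y. h \<in> \<Phi> y})"
  using Phi_G by (auto simp: moving_def)

lemma openin_moving: "openin Y (moving u)"
  unfolding moving_eq using Phi_lsc by blast

lemma moving_equivariant:
  assumes g: "g \<in> G" and y: "y \<in> moving u" shows "act g y \<in> moving (g u)"
proof -
  obtain h where h: "y \<in> topspace Y" "h \<in> \<Phi> y" "h u \<noteq> u" using y by (auto simp: moving_def)
  have "g \<circ> h \<circ> iv g \<in> \<Phi> (act g y)" using Phi_equivariant[OF g h(1)] h(2) by blast
  moreover have "(g \<circ> h \<circ> iv g) (g u) \<noteq> g u" using h(3) G_bij[OF g] G_inj[OF g] by simp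
  ultimately show ?thesis using act_closed[OF g h(1)] unfolding moving_def by blast
qed

lemma moving_mono:
  assumes "u \<in> V" shows "moving (take n u) \<subseteq> moving u"
proof
  fix y assume "y \<in> moving (take n u)"
  then obtain h where h: "y \<in> topspace Y" "h \<in> \<Phi> y" "h (take n u) \<noteq> take n u" by (auto simp: moving_def)
  then have "h \<in> G" using Phi_G by blast
  then have "h u \<noteq> u" using G_take[OF _ assms, of h n] h(3) by auto
  then show "y \<in> moving u" using h by (auto simp: moving_def)
qed

definition below :: "nat list \<Rightarrow> nat \<Rightarrow> nat list set" where
  "below v m = {u \<in> V. length u = m \<and> prefix v u}"

lemma finite_below: "finite (below v m)"
  by (rule finite_subset[OF _ finite_level[OF tree, of m]]) (auto simp: below_def)

lemma fixfree_iff: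
  assumes v: "v \<in> V"
  shows "y \<in> fixfree v \<longleftrightarrow> y \<in> topspace Y \<and> (\<exists>m\<ge>length v. \<forall>u\<in>below v m. y \<in> moving u)"
proof (cases "y \<in> topspace Y")
  case True
  then show ?thesis
    using no_fixed_point_iff[OF tree Phi_aut[OF True] v] by (simp add: fixfree_def moving_def below_def Ball_def imp_conjL)
qed (simp add: fixfree_def)

text \<open>The factor \<open>topspace Y\<close> gives the intended value when
  \<open>below v m\<close> is empty.\<close>

definition moving_level :: "nat list \<Rightarrow> nat \<Rightarrow> 'x set" where
  "moving_level v m = (\<Inter>u\<in>below v m. moving u) \<inter> topspace Y"

lemma openin_moving_level: "openin Y (moving_level v m)"
  unfolding moving_level_def by (rule openin_INT[OF finite_below openin_moving])

lemma fixfree_eq: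
  assumes "v \<in> V" shows "fixfree v = (\<Union>m\<in>{length v..}. moving_level v m)"
  unfolding set_eq_iff fixfree_iff[OF assms] UN_iff moving_level_def by (auto simp: Bex_def)

lemma moving_level_mono:
  assumes "length v \<le> m" "m \<le> m'" shows "moving_level v m \<subseteq> moving_level v m'"
proof
  fix y assume y: "y \<in> moving_level v m"
  have "y \<in> moving u" if u: "u \<in> below v m'" for u
  proof -
    have "take m u \<in> below v m" using u assms tree_take[OF tree, of u m] by (auto simp: below_def prefix_iff_take min_def)
    then show ?thesis using y moving_mono[of u m] u by (auto simp: moving_level_def below_def)
  qed
  then show "y \<in> moving_level v m'" using y by (simp add: moving_level_def)
qed

lemma openin_fixfree: "v \<in> V \<Longrightarrow> openin Y (fixfree v)"
  unfolding fixfree_eq using openin_moving_level by blast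

lemma fixfree_equivariant:
  assumes g: "g \<in> G" and v: "v \<in> V" and y: "y \<in> fixfree v" shows "act g y \<in> fixfree (g v)"
proof -
  obtain m where m: "y \<in> topspace Y" "length v \<le> m" "\<And>u. u \<in> below v m \<Longrightarrow> y \<in> moving u"
    using y fixfree_iff[OF v] by blast
  have "act g y \<in> moving u" if u: "u \<in> below (g v) m" for u
  proof -
    have b: "g (iv g u) = u" using G_bij[OF g] by simp
    have "iv g u \<in> V" using u G_in_iff[OF g, of "iv g u"] b by (simp add: below_def)
    then have "iv g u \<in> below v m"
      using u b G_prefix_iff[OF g v, of "iv g u"] G_length[OF g, of "iv g u"] by (simp add: below_def)
    then show ?thesis using moving_equivariant[OF g m(3)] b by metis
  qed
  then show ?thesis
    using fixfree_iff[of "g v"] G_in_iff[OF g] v act_closed[OF g m(1)] m(2) G_length[OF g v] by metis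
qed

text \<open>Minimality enters here, by counting on the level of \<open>v\<close>. Closedness makes
  the set compact, on which the uniform bounds rest.\<close>

lemma closedin_fixfree: "v \<in> V \<Longrightarrow> closedin Y (fixfree v)"
  by (rule equivariant_open_imp_closed[of "length v" fixfree])
    (simp_all add: openin_fixfree fixfree_equivariant)

lemma compact_subcover:
  assumes "compactin Y A" "\<And>i. i \<in> I \<Longrightarrow> openin Y (U i)" "A \<subseteq> (\<Union>i\<in>I. U i)"
  obtains J where "finite J" "J \<subseteq> I" "A \<subseteq> (\<Union>i\<in>J. U i)"
proof -
  have "\<exists>\<F>. finite \<F> \<and> \<F> \<subseteq> U ` I \<and> A \<subseteq> \<Union>\<F>"
    by (rule compactinD[OF assms(1)]) (use assms(2,3) in auto)
  then show ?thesis using that by (metis finite_subset_image)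
qed

lemma compactin_fixfree: "v \<in> V \<Longrightarrow> compactin Y (fixfree v)"
  using closedin_compact_space[OF compact closedin_fixfree] .

text \<open>The open sets \<open>moving_level v m\<close> increase with \<open>m\<close> and exhaust
  the compact set \<open>fixfree v\<close>.\<close>

lemma fixfree_level:
  assumes v: "v \<in> V" obtains m where "length v \<le> m" "fixfree v \<subseteq> moving_level v m"
proof -
  obtain J where J: "finite J" "J \<subseteq> {length v..}" "fixfree v \<subseteq> (\<Union>m\<in>J. moving_level v m)"
    using compact_subcover[OF compactin_fixfree[OF v], of "{length v..}" "moving_level v"]
      openin_moving_level fixfree_eq[OF v] by (metis order_refl)
  \<comment> \<open>\<open>\<Sum>J\<close> bounds the members of \<open>J\<close>; adding
    \<open>length v\<close> also covers an empty \<open>J\<close>.\<close>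
  have "moving_level v j \<subseteq> moving_level v (length v + \<Sum>J)" if "j \<in> J" for j
  proof (rule moving_level_mono)
    show "length v \<le> j" using J(2) that by auto
    have "j \<le> \<Sum>J" using member_le_sum[of j J "\<lambda>i. i"] J(1) that by simp
    then show "j \<le> length v + \<Sum>J" by simp
  qed
  then have "fixfree v \<subseteq> moving_level v (length v + \<Sum>J)" using J(3) by blast
  then show ?thesis using that[of "length v + \<Sum>J"] by simp
qed

text \<open>A finite subcover by the sets of \<open>y\<close> with \<open>h \<in> \<Phi> y\<close>,
  where \<open>h\<close> moves \<open>u\<close>, supplies the palette of colours.\<close>

lemma fixfree_finite_movers:
  assumes v: "v \<in> V" and u: "fixfree v \<subseteq> moving u"
  obtains P where "finite P" "P \<subseteq> G" "\<And>p. p \<in> P \<Longrightarrow> p u \<noteq> u" "\<And>y. y \<in> fixfree v \<Longrightarrow> \<exists>p\<in>P. p \<in> \<Phi> y"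
proof -
  obtain P where "finite P" "P \<subseteq> {h \<in> G. h u \<noteq> u}" "fixfree v \<subseteq> (\<Union>h\<in>P. {y \<in> topspace Y. h \<in> \<Phi> y})"
    by (rule compact_subcover[OF compactin_fixfree[OF v], of "{h \<in> G. h u \<noteq> u}" "\<lambda>h. {y \<in> topspace Y. h \<in> \<Phi> y}"])
      (use Phi_lsc u in \<open>auto simp: moving_eq\<close>)
  then show ?thesis using that[of P] by auto
qed

text \<open>Let \<open>g\<close> be in \<open>rist V G u\<close> with \<open>u\<close> below
  \<open>v\<close>. It fixes \<open>v\<close>, so \<open>act g y\<close> stays in
  \<open>fixfree v\<close> and some \<open>p\<close> of the palette lies in
  \<open>\<Phi> (act g y)\<close>. By equivariance \<open>iv g \<circ> p \<circ> g\<close> is in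
  \<open>\<Phi> y\<close>, as \<open>confined_contains_commutators\<close> demands.\<close>

lemma rist_commutators_below:
  assumes v: "v \<in> V"
  shows "\<exists>l. \<forall>y\<in>fixfree v. \<forall>z\<in>V. prefix v z \<and> l \<le> length z \<longrightarrow>
    (\<forall>a\<in>rist V G z. \<forall>b\<in>rist V G z. a \<circ> b \<circ> iv a \<circ> iv b \<in> \<Phi> y)"
proof -
  obtain m where m: "length v \<le> m" "fixfree v \<subseteq> moving_level v m" using fixfree_level[OF v] .
  have "\<exists>l. \<forall>y\<in>fixfree v. \<forall>z\<in>V. prefix u z \<and> l \<le> length z \<longrightarrow>
    (\<forall>a\<in>rist V G z. \<forall>b\<in>rist V G z. a \<circ> b \<circ> iv a \<circ> iv b \<in> \<Phi> y)" if u: "u \<in> below v m" for u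
  proof -
    have uV: "u \<in> V" "prefix v u" using u by (auto simp: below_def)
    have vu: "fixfree v \<subseteq> moving u" using m(2) u by (auto simp: moving_level_def)
    obtain P where P: "finite P" "P \<subseteq> G" "\<And>p. p \<in> P \<Longrightarrow> p u \<noteq> u"
      "\<And>y. y \<in> fixfree v \<Longrightarrow> \<exists>p\<in>P. p \<in> \<Phi> y" by (rule fixfree_finite_movers[OF v vu]) blast
    obtain l where l: "\<forall>H. subgroup H (aut_group V) \<and> H \<subseteq> G \<and> (\<forall>g\<in>rist V G u. \<exists>p\<in>P. iv g \<circ> p \<circ> g \<in> H) \<longrightarrow>
      (\<forall>z\<in>V. prefix u z \<and> l \<le> length z \<longrightarrow>
        (\<forall>a\<in>rist V G z. \<forall>b\<in>rist V G z. a \<circ> b \<circ> iv a \<circ> iv b \<in> H))"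
      using confined_contains_commutators[OF uV(1) P(1,2)] P(3) by auto
    have "a \<circ> b \<circ> iv a \<circ> iv b \<in> \<Phi> y"
      if y: "y \<in> fixfree v" and z: "z \<in> V" "prefix u z" "l \<le> length z"
        and ab: "a \<in> rist V G z" "b \<in> rist V G z" for y z a b
    proof -
      have yt: "y \<in> topspace Y" using y by (simp add: fixfree_def)
      have "\<exists>p\<in>P. iv g \<circ> p \<circ> g \<in> \<Phi> y" if g: "g \<in> rist V G u" for g
      proof -
      have gG: "g \<in> G" using rist_G[OF g] .
      have "g v = v"
        using G_take[OF gG uV(1), of "length v"] rist_root[OF g uV(1)] uV(2) by (simp add: prefix_iff_take)
      then have "act g y \<in> fixfree v" using fixfree_equivariant[OF gG v y] by simp
      then obtain p where p: "p \<in> P" "p \<in> \<Phi> (act g y)" using P(4) by blast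
      then obtain h where h: "h \<in> \<Phi> y" "p = g \<circ> h \<circ> iv g" using Phi_equivariant[OF gG yt] by auto
      have "bij h" using h(1) Phi_G[OF yt] G_bij by blast
      then have "iv g \<circ> p \<circ> g = h" using h(2) G_bij[OF gG] by (simp add: bij_group_simps)
      then show ?thesis using p(1) h(1) by blast
      qed
      then show ?thesis using l Phi_subgroup[OF yt] Phi_G[OF yt] z ab by simp
    qed
    then show ?thesis by blast
  qed
  then obtain l where l: "\<And>u y z a b. u \<in> below v m \<Longrightarrow> y \<in> fixfree v \<Longrightarrow> z \<in> V \<Longrightarrow> prefix u z \<Longrightarrow> l u \<le> length z \<Longrightarrow>
    a \<in> rist V G z \<Longrightarrow> b \<in> rist V G z \<Longrightarrow> a \<circ> b \<circ> iv a \<circ> iv b \<in> \<Phi> y" by metis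
  show ?thesis
  proof (intro exI ballI impI)
    fix y z a b
    assume y: "y \<in> fixfree v" and z: "z \<in> V" "prefix v z \<and> m + sum l (below v m) \<le> length z"
      and ab: "a \<in> rist V G z" "b \<in> rist V G z"
    have u: "take m z \<in> below v m"
      using z m(1) tree_take[OF tree z(1), of m] by (auto simp: below_def prefix_iff_take min_def)
    then have "l (take m z) \<le> length z" using z member_le_sum[OF u, of l] finite_below by fastforce
    then show "a \<circ> b \<circ> iv a \<circ> iv b \<in> \<Phi> y" using l[OF u y z(1) take_is_prefix _ ab] by blast
  qed
qed

text \<open>Summing over a finite level leaves a bound depending on the level alone, so that
  subdividing by it commutes with automorphisms.\<close>

lemma uniform_level:
  "\<exists>\<mu> :: nat \<Rightarrow> nat. (\<forall>n. n \<le> \<mu> n) \<and> (\<forall>v\<in>V. \<forall>y\<in>fixfree v. \<forall>z\<in>V. prefix v z \<and> \<mu> (length v) \<le> length z \<longrightarrow>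
    (\<forall>a\<in>rist V G z. \<forall>b\<in>rist V G z. a \<circ> b \<circ> iv a \<circ> iv b \<in> \<Phi> y))"
proof -
  obtain l where l: "\<And>v y z a b. v \<in> V \<Longrightarrow> y \<in> fixfree v \<Longrightarrow> z \<in> V \<Longrightarrow> prefix v z \<Longrightarrow> l v \<le> length z \<Longrightarrow>
      a \<in> rist V G z \<Longrightarrow> b \<in> rist V G z \<Longrightarrow> a \<circ> b \<circ> iv a \<circ> iv b \<in> \<Phi> y"
    using rist_commutators_below by metis
  define \<mu> where "\<mu> n = n + sum l {v \<in> V. length v = n}" for n
  show ?thesis
  proof (intro exI[of _ \<mu>] conjI allI ballI impI)
    show "n \<le> \<mu> n" for n by (simp add: \<mu>_def)
    fix v y z a b
    assume A: "v \<in> V" "y \<in> fixfree v" "z \<in> V" "prefix v z \<and> \<mu> (length v) \<le> length z"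
      "a \<in> rist V G z" "b \<in> rist V G z"
    have "l v \<le> \<mu> (length v)"
      using member_le_sum[of v "{w \<in> V. length w = length v}" l] A(1) finite_level[OF tree] by (simp add: \<mu>_def trans_le_add2)
    then show "a \<circ> b \<circ> iv a \<circ> iv b \<in> \<Phi> y" using l A by (meson order_trans)
  qed
qed

end

section \<open>Fixed point sets and the map to independent vertices\<close>

lemma topspace_vietoris: "topspace (vietoris T) = {F. closedin T F}"
proof -
  have "openin T (topspace T)" by simp
  then have "F \<in> \<Union> {{F. closedin T F \<and> F \<subseteq> U} |U. openin T U}" if "closedin T F" for F
    using that closedin_subset[OF that] by blast
  then show ?thesis unfolding vietoris_def by auto
qed

context lsc_map
begin

text \<open>Openness of \<open>fixfree\<close> handles the condition of being contained in an open
  set, closedness that of meeting one.\<close>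

lemma continuous_Fix: "continuous_map Y (vietoris (boundary_top V)) (\<lambda>x. Fix V (\<Phi> x))"
  unfolding vietoris_def
proof (rule continuous_on_generated_topo)
  have closed: "closedin (boundary_top V) (Fix V (\<Phi> y))" if "y \<in> topspace Y" for y
    using closedin_Fix[OF tree Phi_aut[OF that]] .
  have sub: "Fix V (\<Phi> y) \<subseteq> boundary V" for y by (auto simp: Fix_def)
  have upper: "openin Y {y \<in> topspace Y. Fix V (\<Phi> y) \<subseteq> U}" if U: "openin (boundary_top V) U" for U
  proof (subst openin_subopen, intro ballI)
    fix y assume "y \<in> {y \<in> topspace Y. Fix V (\<Phi> y) \<subseteq> U}"
    then have y: "y \<in> topspace Y" "Fix V (\<Phi> y) \<subseteq> U" by auto
    obtain m where m: "\<And>w. w \<in> V \<Longrightarrow> length w = m \<Longrightarrow> Fix V (\<Phi> y) \<inter> boundary_sub V w = {} \<or> boundary_sub V w \<subseteq> U"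
      using closed_subset_open_level[OF tree closed[OF y(1)] U y(2)] by blast
    \<comment> \<open>Cylinders over \<open>I\<close> stay free of fixed points throughout
      \<open>W\<close>, and the other cylinders of level \<open>m\<close> lie in
      \<open>U\<close>.\<close>
    define I where "I = {w \<in> V. length w = m \<and> y \<in> fixfree w}"
    define W where "W = (\<Inter>w\<in>I. fixfree w) \<inter> topspace Y"
    have "finite I" by (rule finite_subset[OF _ finite_level[OF tree, of m]]) (auto simp: I_def)
    then have "openin Y W" unfolding W_def by (rule openin_INT) (simp add: I_def openin_fixfree)
    moreover have "y \<in> W" using y by (auto simp: W_def I_def)
    moreover have "Fix V (\<Phi> z) \<subseteq> U" if z: "z \<in> W" for z
    proof
      fix \<xi> assume \<xi>: "\<xi> \<in> Fix V (\<Phi> z)"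
      then have b: "\<xi> \<in> boundary V" using sub by blast
      let ?w = "initial \<xi> m"
      have "z \<notin> fixfree ?w" using \<xi> boundary_sub_initial[OF b] unfolding fixfree_def by blast
      then have "?w \<notin> I" using z unfolding W_def by blast
      then have "y \<notin> fixfree ?w" using initial_in[OF b] by (simp add: I_def)
      then have "boundary_sub V ?w \<subseteq> U" using m[of ?w] initial_in[OF b] y(1) by (simp add: fixfree_def)
      then show "\<xi> \<in> U" using boundary_sub_initial[OF b] by blast
    qed
    moreover have "W \<subseteq> topspace Y" by (simp add: W_def)
    ultimately show "\<exists>T. openin Y T \<and> y \<in> T \<and> T \<subseteq> {y \<in> topspace Y. Fix V (\<Phi> y) \<subseteq> U}"
      by (intro exI[of _ W]) auto
  qed
  have lower: "openin Y {y \<in> topspace Y. Fix V (\<Phi> y) \<inter> U \<noteq> {}}" if U: "openin (boundary_top V) U" for U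
  proof (subst openin_subopen, intro ballI)
    fix y assume "y \<in> {y \<in> topspace Y. Fix V (\<Phi> y) \<inter> U \<noteq> {}}"
    then obtain \<xi> where y: "y \<in> topspace Y" and \<xi>: "\<xi> \<in> Fix V (\<Phi> y)" "\<xi> \<in> U" by blast
    have b: "\<xi> \<in> boundary V" using \<xi>(1) sub by blast
    obtain n where n: "boundary_sub V (initial \<xi> n) \<subseteq> U" using boundary_nbhd[OF U \<xi>(2)] .
    let ?W = "topspace Y - fixfree (initial \<xi> n)"
    have "openin Y ?W" using closedin_fixfree[OF initial_in[OF b]] by (simp add: closedin_def)
    moreover have "y \<in> ?W" using y \<xi>(1) boundary_sub_initial[OF b] unfolding fixfree_def by blast
    moreover have "?W \<subseteq> {y \<in> topspace Y. Fix V (\<Phi> y) \<inter> U \<noteq> {}}" using n unfolding fixfree_def by blast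
    ultimately show "\<exists>T. openin Y T \<and> y \<in> T \<and> T \<subseteq> {y \<in> topspace Y. Fix V (\<Phi> y) \<inter> U \<noteq> {}}" by blast
  qed
  fix S assume "S \<in> {{F. closedin (boundary_top V) F \<and> F \<subseteq> U} |U. openin (boundary_top V) U} \<union>
    {{F. closedin (boundary_top V) F \<and> F \<inter> U \<noteq> {}} |U. openin (boundary_top V) U}"
  then consider U where "openin (boundary_top V) U" "S = {F. closedin (boundary_top V) F \<and> F \<subseteq> U}"
    | U where "openin (boundary_top V) U" "S = {F. closedin (boundary_top V) F \<and> F \<inter> U \<noteq> {}}" by blast
  then show "openin Y ((\<lambda>x. Fix V (\<Phi> x)) -` S \<inter> topspace Y)"
  proof cases
    case (1 U)
    have "(\<lambda>x. Fix V (\<Phi> x)) -` S \<inter> topspace Y = {y \<in> topspace Y. Fix V (\<Phi> y) \<subseteq> U}"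
      using closed by (auto simp: 1(2))
    then show ?thesis using upper[OF 1(1)] by simp
  next
    case (2 U)
    have "(\<lambda>x. Fix V (\<Phi> x)) -` S \<inter> topspace Y = {y \<in> topspace Y. Fix V (\<Phi> y) \<inter> U \<noteq> {}}"
      using closed by (auto simp: 2(2))
    then show ?thesis using lower[OF 2(1)] by simp
  qed
next
  show "(\<lambda>x. Fix V (\<Phi> x)) ` topspace Y
    \<subseteq> \<Union> ({{F. closedin (boundary_top V) F \<and> F \<subseteq> U} |U. openin (boundary_top V) U} \<union>
           {{F. closedin (boundary_top V) F \<and> F \<inter> U \<noteq> {}} |U. openin (boundary_top V) U})"
    unfolding topspace_vietoris[of "boundary_top V", unfolded vietoris_def topology_generated_by_topspace]
    using closedin_Fix[OF tree Phi_aut] by blast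
qed

end

definition avoids :: "nat list set \<Rightarrow> (nat \<Rightarrow> nat) set \<Rightarrow> nat list \<Rightarrow> bool" where
  "avoids V F v \<longleftrightarrow> F \<inter> boundary_sub V v = {}"

text \<open>Each maximal vertex whose cylinder avoids \<open>F\<close>, say of level \<open>j\<close>, is replaced by its descendants of level \<open>\<mu> j\<close>.\<close>

definition gap_vertices :: "nat list set \<Rightarrow> (nat \<Rightarrow> nat) \<Rightarrow> (nat \<Rightarrow> nat) set \<Rightarrow> nat list set" where
  "gap_vertices V \<mu> F = {w \<in> V. \<exists>j\<le>length w. length w = \<mu> j \<and> avoids V F (take j w) \<and> (\<forall>i<j. \<not> avoids V F (take i w))}"

text \<open>For two members with a common extension \<open>x\<close>, the first avoiding level is in
  both cases read from \<open>x\<close>. So the levels agree, and both members are the prefix of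
  \<open>x\<close> of the same length.\<close>

lemma gap_vertices_Pi_T: "gap_vertices V \<mu> F \<in> Pi_T V"
proof -
  have "v = w"
    if v: "v \<in> gap_vertices V \<mu> F" and w: "w \<in> gap_vertices V \<mu> F" and x: "prefix v x" "prefix w x" for v w x
  proof -
    obtain j where j: "j \<le> length v" "length v = \<mu> j" "avoids V F (take j v)" "\<And>i. i < j \<Longrightarrow> \<not> avoids V F (take i v)"
      using v by (auto simp: gap_vertices_def)
    obtain k where k: "k \<le> length w" "length w = \<mu> k" "avoids V F (take k w)" "\<And>i. i < k \<Longrightarrow> \<not> avoids V F (take i w)"
      using w by (auto simp: gap_vertices_def)
    have tv: "take i v = take i x" if "i \<le> length v" for i
      using x(1) that by (metis min.absorb1 prefix_iff_take take_take)
    have tw: "take i w = take i x" if "i \<le> length w" for i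
      using x(2) that by (metis min.absorb1 prefix_iff_take take_take)
    have "j = k"
    proof (rule antisym; rule ccontr)
      assume "\<not> j \<le> k"
      then show False using j(4)[of k] k(1,3) tv[of k] tw[of k] j(1) by simp
    next
      assume "\<not> k \<le> j"
      then show False using k(4)[of j] j(1,3) tv[of j] tw[of j] k(1) by simp
    qed
    then show "v = w" using x j(2) k(2) by (metis prefix_iff_take)
  qed
  then show ?thesis unfolding Pi_T_def subtree_def gap_vertices_def by blast
qed

text \<open>A ray outside the closed \<open>F\<close> has a first avoiding prefix, of length
  \<open>j\<close> say; its prefix of length \<open>\<mu> j\<close> is then selected.\<close>

lemma pi_perp_gap_vertices:
  assumes F: "closedin (boundary_top V) F" and \<mu>: "\<And>n. n \<le> \<mu> n"
  shows "pi_perp V (gap_vertices V \<mu> F) = F"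
proof (intro subset_antisym subsetI)
  fix \<xi> assume \<xi>: "\<xi> \<in> pi_perp V (gap_vertices V \<mu> F)"
  then have b: "\<xi> \<in> boundary V" by (simp add: pi_perp_def)
  show "\<xi> \<in> F"
  proof (rule ccontr)
    assume "\<xi> \<notin> F"
    then have ex: "\<exists>n. avoids V F (initial \<xi> n)"
      using F b unfolding closedin_boundary_iff avoids_def by blast
    define j where "j = (LEAST n. avoids V F (initial \<xi> n))"
    have j: "avoids V F (initial \<xi> j)" unfolding j_def by (rule LeastI_ex[OF ex])
    have lt: "\<not> avoids V F (initial \<xi> i)" if "i < j" for i
      using not_less_Least[OF that[unfolded j_def]] .
    let ?w = "initial \<xi> (\<mu> j)"
    have t: "take i ?w = initial \<xi> i" if "i \<le> j" for i using take_initial that \<mu>[of j] order_trans by blast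
    have "?w \<in> gap_vertices V \<mu> F"
      unfolding gap_vertices_def using initial_in[OF b] j lt t \<mu>[of j] by (intro CollectI conjI exI[of _ j]) auto
    then show False using \<xi> boundary_sub_initial[OF b] unfolding pi_perp_def by blast
  qed
next
  fix \<xi> assume \<xi>: "\<xi> \<in> F"
  have b: "\<xi> \<in> boundary V" using F \<xi> unfolding closedin_boundary_iff by blast
  have "\<xi> \<notin> boundary_sub V w" if w: "w \<in> gap_vertices V \<mu> F" for w
  proof
    assume \<xi>w: "\<xi> \<in> boundary_sub V w"
    obtain j where "avoids V F (take j w)" using w unfolding gap_vertices_def by blast
    moreover have "\<xi> \<in> boundary_sub V (take j w)"
      using boundary_sub_mono[OF take_is_prefix[of j w], of V] \<xi>w by blast
    ultimately show False using \<xi> unfolding avoids_def by blast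
  qed
  then show "\<xi> \<in> pi_perp V (gap_vertices V \<mu> F)" using b unfolding pi_perp_def by blast
qed

text \<open>The selection uses only levels and \<open>avoids\<close>; both are transported by
  \<open>g\<close>.\<close>

lemma gap_vertices_equivariant:
  assumes tree: "rooted_tree V" and g: "g \<in> aut V" and F: "F \<subseteq> boundary V"
  shows "gap_vertices V \<mu> (bact g ` F) = g ` gap_vertices V \<mu> F"
proof -
  have av: "avoids V (bact g ` F) (take i (g w)) \<longleftrightarrow> avoids V F (take i w)" if w: "w \<in> V" for w i
  proof -
    have "bact g \<xi> \<in> boundary_sub V (take i (g w)) \<longleftrightarrow> \<xi> \<in> boundary_sub V (take i w)" if "\<xi> \<in> F" for \<xi>
      using bact_boundary_sub_iff[OF tree g _ tree_take[OF tree w, of i], of \<xi>] that F aut_take[OF tree g w, of i] by auto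
    then show ?thesis unfolding avoids_def by blast
  qed
  have iff: "g w \<in> gap_vertices V \<mu> (bact g ` F) \<longleftrightarrow> w \<in> gap_vertices V \<mu> F" if "w \<in> V" for w
    using that aut_in_iff[OF tree g] aut_length[OF tree g] by (simp add: gap_vertices_def av)
  show ?thesis
  proof (intro subset_antisym subsetI)
    fix x assume x: "x \<in> gap_vertices V \<mu> (bact g ` F)"
    have e: "g (iv g x) = x" using aut_bij[OF tree g] by simp
    have "x \<in> V" using x by (simp add: gap_vertices_def)
    then have "iv g x \<in> V" using aut_in_iff[OF tree g, of "iv g x"] e by simp
    then have "iv g x \<in> gap_vertices V \<mu> F" using iff x e by metis
    then show "x \<in> g ` gap_vertices V \<mu> F" using e by (metis image_eqI)
  next
    fix x assume "x \<in> g ` gap_vertices V \<mu> F"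
    then obtain w where w: "w \<in> gap_vertices V \<mu> F" "x = g w" by blast
    then have "w \<in> V" by (simp add: gap_vertices_def)
    then show "x \<in> gap_vertices V \<mu> (bact g ` F)" using iff w by blast
  qed
qed

section \<open>Clopen conditions and continuity of the vertex selection\<close>

definition clopen_pred :: "'a topology \<Rightarrow> ('a \<Rightarrow> bool) \<Rightarrow> bool" where
  "clopen_pred Z P \<longleftrightarrow> openin Z {x \<in> topspace Z. P x} \<and> openin Z {x \<in> topspace Z. \<not> P x}"

lemma clopen_pred_not: "clopen_pred Z P \<Longrightarrow> clopen_pred Z (\<lambda>x. \<not> P x)"
  by (simp add: clopen_pred_def)

lemma clopen_pred_Bex:
  assumes "finite I" "\<And>i. i \<in> I \<Longrightarrow> clopen_pred Z (P i)"
  shows "clopen_pred Z (\<lambda>x. \<exists>i\<in>I. P i x)"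
proof -
  have "openin Z (\<Union>i\<in>I. {x \<in> topspace Z. P i x})" using assms(2) by (auto simp: clopen_pred_def)
  moreover have "openin Z ((\<Inter>i\<in>I. {x \<in> topspace Z. \<not> P i x}) \<inter> topspace Z)"
    using assms by (intro openin_INT) (auto simp: clopen_pred_def)
  moreover have "(\<Union>i\<in>I. {x \<in> topspace Z. P i x}) = {x \<in> topspace Z. \<exists>i\<in>I. P i x}"
    "(\<Inter>i\<in>I. {x \<in> topspace Z. \<not> P i x}) \<inter> topspace Z = {x \<in> topspace Z. \<not> (\<exists>i\<in>I. P i x)}" by auto
  ultimately show ?thesis by (simp add: clopen_pred_def)
qed

lemma clopen_pred_conj:
  assumes "clopen_pred Z P" "clopen_pred Z Q" shows "clopen_pred Z (\<lambda>x. P x \<and> Q x)"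
proof -
  have "openin Z ({x \<in> topspace Z. P x} \<inter> {x \<in> topspace Z. Q x})"
    "openin Z ({x \<in> topspace Z. \<not> P x} \<union> {x \<in> topspace Z. \<not> Q x})"
    using assms by (auto simp: clopen_pred_def)
  moreover have "{x \<in> topspace Z. P x} \<inter> {x \<in> topspace Z. Q x} = {x \<in> topspace Z. P x \<and> Q x}"
    "{x \<in> topspace Z. \<not> P x} \<union> {x \<in> topspace Z. \<not> Q x} = {x \<in> topspace Z. \<not> (P x \<and> Q x)}" by auto
  ultimately show ?thesis by (simp add: clopen_pred_def)
qed

text \<open>A cylinder is clopen, so meeting it and missing it are both subbasic Vietoris
  conditions.\<close>

lemma clopen_pred_avoids: "clopen_pred (subtopology (vietoris (boundary_top V)) A) (\<lambda>F. avoids V F v)"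
proof -
  let ?T = "boundary_top V"
  have op: "openin ?T (boundary_sub V v)" "openin ?T (boundary V - boundary_sub V v)"
    using openin_boundary_sub closedin_boundary_sub[of V v] by (auto simp: closedin_def)
  have "openin (vietoris ?T) {F. closedin ?T F \<and> F \<inter> boundary_sub V v \<noteq> {}}"
    "openin (vietoris ?T) {F. closedin ?T F \<and> F \<subseteq> boundary V - boundary_sub V v}"
    unfolding vietoris_def using op by (auto intro!: topology_generated_by_Basis)
  moreover have "{F \<in> topspace (subtopology (vietoris ?T) A). \<not> avoids V F v}
      = {F. closedin ?T F \<and> F \<inter> boundary_sub V v \<noteq> {}} \<inter> A"
    by (auto simp: topspace_vietoris avoids_def)
  moreover have "{F \<in> topspace (subtopology (vietoris ?T) A). avoids V F v}
      = {F. closedin ?T F \<and> F \<subseteq> boundary V - boundary_sub V v} \<inter> A"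
    using closedin_subset[of ?T] by (auto simp: topspace_vietoris avoids_def)
  ultimately show ?thesis by (simp only: clopen_pred_def openin_subtopology_Int)
qed

text \<open>Whether \<open>a\<close> is selected is a Boolean combination of the conditions
  \<open>avoids\<close> at the finitely many prefixes of \<open>a\<close>.\<close>

lemma continuous_gap_vertices:
  assumes "V \<noteq> {}"
  shows "continuous_map (subtopology (vietoris (boundary_top V)) A) (Pi_top V) (gap_vertices V \<mu>)"
proof -
  let ?Z = "subtopology (vietoris (boundary_top V)) A"
  have cl: "clopen_pred ?Z (\<lambda>F. a \<in> gap_vertices V \<mu> F)" if a: "a \<in> V" for a
  proof -
    have "clopen_pred ?Z (\<lambda>F. \<exists>j\<in>{j. j \<le> length a \<and> length a = \<mu> j}.
        avoids V F (take j a) \<and> \<not> (\<exists>i\<in>{..<j}. avoids V F (take i a)))"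
      by (intro clopen_pred_Bex clopen_pred_conj clopen_pred_not clopen_pred_avoids) auto
    moreover have "(\<lambda>F. a \<in> gap_vertices V \<mu> F) = (\<lambda>F. \<exists>j\<in>{j. j \<le> length a \<and> length a = \<mu> j}.
        avoids V F (take j a) \<and> \<not> (\<exists>i\<in>{..<j}. avoids V F (take i a)))"
      using a by (auto simp: gap_vertices_def fun_eq_iff)
    ultimately show ?thesis by simp
  qed
  have inV: "gap_vertices V \<mu> F \<subseteq> V" for F by (auto simp: gap_vertices_def)
  have "continuous_map ?Z (subset_top V) (gap_vertices V \<mu>)"
    unfolding subset_top_def
  proof (rule continuous_on_generated_topo)
    fix U assume "U \<in> {{S. S \<subseteq> V \<and> a \<in> S} |a. a \<in> V} \<union> {{S. S \<subseteq> V \<and> a \<notin> S} |a. a \<in> V}"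
    then consider a where "a \<in> V" "U = {S. S \<subseteq> V \<and> a \<in> S}" | a where "a \<in> V" "U = {S. S \<subseteq> V \<and> a \<notin> S}" by blast
    then show "openin ?Z (gap_vertices V \<mu> -` U \<inter> topspace ?Z)"
    proof cases
      case (1 a)
      have "gap_vertices V \<mu> -` U \<inter> topspace ?Z = {F \<in> topspace ?Z. a \<in> gap_vertices V \<mu> F}"
        unfolding 1(2) using inV by blast
      then show ?thesis using cl[OF 1(1)] by (simp only: clopen_pred_def)
    next
      case (2 a)
      have "gap_vertices V \<mu> -` U \<inter> topspace ?Z = {F \<in> topspace ?Z. a \<notin> gap_vertices V \<mu> F}"
        unfolding 2(2) using inV by blast
      then show ?thesis using cl[OF 2(1)] by (simp only: clopen_pred_def)
    qed
  next
    \<comment> \<open>The space of a generated topology is the union of its subbasis, so some vertex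
      is needed to place \<open>S\<close> in it.\<close>
    show "gap_vertices V \<mu> ` topspace ?Z \<subseteq> \<Union> ({{S. S \<subseteq> V \<and> a \<in> S} |a. a \<in> V} \<union> {{S. S \<subseteq> V \<and> a \<notin> S} |a. a \<in> V})"
    proof
      fix S assume "S \<in> gap_vertices V \<mu> ` topspace ?Z"
      then have S: "S \<subseteq> V" using inV by blast
      show "S \<in> \<Union> ({{S. S \<subseteq> V \<and> a \<in> S} |a. a \<in> V} \<union> {{S. S \<subseteq> V \<and> a \<notin> S} |a. a \<in> V})"
      proof -
        obtain a where "a \<in> V" using assms by blast
        then show ?thesis using S by (cases "a \<in> S") blast+
      qed
    qed
  qed
  then show ?thesis unfolding Pi_top_def continuous_map_in_subtopology using gap_vertices_Pi_T by blast
qed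

theorem theorem5p22:
  fixes V :: "nat list set"
    and G :: "(nat list \<Rightarrow> nat list) set"
    and Y :: "'x topology"
    and act :: "(nat list \<Rightarrow> nat list) \<Rightarrow> 'x \<Rightarrow> 'x"
    and \<Phi> :: "'x \<Rightarrow> (nat list \<Rightarrow> nat list) set"
  assumes tree: "rooted_tree V"
    and sub: "subgroup G (aut_group V)"
    and wb: "weakly_branch V G"
    and cpt: "compact_space Y" and haus: "Hausdorff_space Y"
    and action: "top_action ((aut_group V)\<lparr>carrier := G\<rparr>) Y act"
    and minimal: "minimal_action ((aut_group V)\<lparr>carrier := G\<rparr>) Y act"
    and Phi_sub: "\<forall>x\<in>topspace Y. subgroup (\<Phi> x) ((aut_group V)\<lparr>carrier := G\<rparr>)"
    and Phi_equiv: "sub_equivariant ((aut_group V)\<lparr>carrier := G\<rparr>) Y act \<Phi>"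
    and Phi_lsc: "sub_lsc ((aut_group V)\<lparr>carrier := G\<rparr>) Y \<Phi>"
  shows "continuous_map Y (vietoris (boundary_top V)) (\<lambda>x. Fix V (\<Phi> x))
    \<and> (\<exists>\<sigma>. continuous_map
              (subtopology (vietoris (boundary_top V)) ((\<lambda>x. Fix V (\<Phi> x)) ` topspace Y))
              (Pi_top V) \<sigma>
         \<and> (\<forall>g\<in>G. \<forall>F\<in>(\<lambda>x. Fix V (\<Phi> x)) ` topspace Y. \<sigma> (bact g ` F) = g ` \<sigma> F)
         \<and> (\<forall>F\<in>(\<lambda>x. Fix V (\<Phi> x)) ` topspace Y. pi_perp V (\<sigma> F) = F)
         \<and> (\<forall>x\<in>topspace Y. \<forall>v\<in>\<sigma> (Fix V (\<Phi> x)).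
               derived (aut_group V) (rist V G v) \<subseteq> \<Phi> x))"
proof -
  interpret b: branch_group V G
    by (rule branch_group.intro) (use tree sub wb in \<open>simp_all add: weakly_branch_def\<close>)
  have Phi_G: "\<Phi> y \<subseteq> G" if "y \<in> topspace Y" for y
    using subgroup.subset[of "\<Phi> y" "(aut_group V)\<lparr>carrier := G\<rparr>"] Phi_sub that by simp
  have Phi_subgroup: "subgroup (\<Phi> y) (aut_group V)" if "y \<in> topspace Y" for y
    using group.incl_subgroup[OF group_aut[OF tree] sub] Phi_sub that by blast
  have inv_G: "inv\<^bsub>(aut_group V)\<lparr>carrier := G\<rparr>\<^esub> g = iv g" if "g \<in> G" for g
    using group.m_inv_consistent[OF group_aut[OF tree] sub that] inv_aut_group[OF tree b.G_aut[OF that]] by simp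
  interpret lsc_map V G Y act \<Phi>
  proof (intro lsc_map.intro lsc_map_axioms.intro b.branch_group_axioms)
    show "compact_space Y" by (rule cpt)
    fix g y assume g: "g \<in> G" and y: "y \<in> topspace Y"
    have "continuous_map Y Y (act g)" using action g by (simp add: top_action_def)
    then show gy: "act g y \<in> topspace Y" using y by (auto simp: continuous_map_def)
    have "act (iv g \<circ> g) y = act (iv g) (act g y)"
      using action g y b.G_iv[OF g] by (simp add: top_action_def aut_group_def)
    moreover have "act id y = y" using action y by (simp add: top_action_def aut_group_def)
    ultimately show "act (iv g) (act g y) = y" using b.G_bij[OF g] by (simp add: iv_comp_cancel)
    show "\<Phi> (act g y) = (\<lambda>h. g \<circ> h \<circ> iv g) ` \<Phi> y"
      using Phi_equiv g y inv_G[OF g] by (simp add: sub_equivariant_def aut_group_def)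
  next
    show "C = {} \<or> C = topspace Y" if "closedin Y C" "\<And>g. g \<in> G \<Longrightarrow> act g ` C \<subseteq> C" for C
      using minimal that by (simp add: minimal_action_def)
    show "openin Y {y \<in> topspace Y. g \<in> \<Phi> y}" if "g \<in> G" for g
      using Phi_lsc that by (simp add: sub_lsc_def)
  qed (use Phi_G Phi_subgroup in blast)+
  obtain \<mu> :: "nat \<Rightarrow> nat" where \<mu>: "(\<forall>n. n \<le> \<mu> n) \<and> (\<forall>v\<in>V. \<forall>y\<in>fixfree v. \<forall>z\<in>V. prefix v z \<and> \<mu> (length v) \<le> length z \<longrightarrow>
    (\<forall>a\<in>rist V G z. \<forall>b\<in>rist V G z. a \<circ> b \<circ> iv a \<circ> iv b \<in> \<Phi> y))"
    using uniform_level ..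
  then have \<mu>_ge: "n \<le> \<mu> n" for n by blast
  have closed: "closedin (boundary_top V) F" if F: "F \<in> (\<lambda>x. Fix V (\<Phi> x)) ` topspace Y" for F
    using F closedin_Fix[OF tree Phi_aut] by blast
  have derived: "derived (aut_group V) (rist V G v) \<subseteq> \<Phi> x"
    if x: "x \<in> topspace Y" and v: "v \<in> gap_vertices V \<mu> (Fix V (\<Phi> x))" for x v
  proof -
    obtain j where j: "v \<in> V" "j \<le> length v" "length v = \<mu> j" "avoids V (Fix V (\<Phi> x)) (take j v)"
      using v by (auto simp: gap_vertices_def)
    \<comment> \<open>The avoiding vertex \<open>take j v\<close> has level \<open>j\<close>, and
      \<open>v\<close> lies below it at level \<open>\<mu> j\<close>, deep enough for the uniform
      bound.\<close>
    have xf: "x \<in> fixfree (take j v)" using x j(4) by (simp add: fixfree_def avoids_def)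
    have comm: "a \<circ> b \<circ> iv a \<circ> iv b \<in> \<Phi> x" if "a \<in> rist V G v" "b \<in> rist V G v" for a b
    proof -
      have "take j v \<in> V" "prefix (take j v) v" "\<mu> (length (take j v)) \<le> length v"
        using tree_take[OF tree j(1)] j take_is_prefix by (simp_all add: min_def)
      then show ?thesis using \<mu> xf j(1) that by blast
    qed
    have "derived_set (aut_group V) (rist V G v) \<subseteq> \<Phi> x"
    proof (intro UN_least)
      fix a c assume ac: "a \<in> rist V G v" "c \<in> rist V G v"
      then have "a \<in> aut V" "c \<in> aut V" using b.G_aut b.rist_G by blast+
      then show "{a \<otimes>\<^bsub>aut_group V\<^esub> c \<otimes>\<^bsub>aut_group V\<^esub> inv\<^bsub>aut_group V\<^esub> a \<otimes>\<^bsub>aut_group V\<^esub> inv\<^bsub>aut_group V\<^esub> c} \<subseteq> \<Phi> x"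
        using comm[OF ac] inv_aut_group[OF tree] by (simp add: aut_group_def)
    qed
    then show ?thesis unfolding derived_def
      by (rule group.generate_subgroup_incl[OF group_aut[OF tree] _ Phi_subgroup[OF x]])
  qed
  show ?thesis
  proof (intro conjI exI[of _ "gap_vertices V \<mu>"] ballI)
    show "continuous_map Y (vietoris (boundary_top V)) (\<lambda>x. Fix V (\<Phi> x))" by (rule continuous_Fix)
    show "continuous_map (subtopology (vietoris (boundary_top V)) ((\<lambda>x. Fix V (\<Phi> x)) ` topspace Y))
        (Pi_top V) (gap_vertices V \<mu>)"
      by (rule continuous_gap_vertices) (use tree in \<open>auto simp: rooted_tree_def\<close>)
  next
    fix g F assume "g \<in> G" "F \<in> (\<lambda>x. Fix V (\<Phi> x)) ` topspace Y"
    then show "gap_vertices V \<mu> (bact g ` F) = g ` gap_vertices V \<mu> F"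
      using gap_vertices_equivariant[OF tree b.G_aut] closedin_subset[OF closed] by simp
  next
    fix F assume "F \<in> (\<lambda>x. Fix V (\<Phi> x)) ` topspace Y"
    then show "pi_perp V (gap_vertices V \<mu> F) = F" using pi_perp_gap_vertices[OF closed \<mu>_ge] by blast
  next
    fix x v assume "x \<in> topspace Y" "v \<in> gap_vertices V \<mu> (Fix V (\<Phi> x))"
    then show "derived (aut_group V) (rist V G v) \<subseteq> \<Phi> x" by (rule derived)
  qed
qed

end
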